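(* Let $X$ be a super-reflexive Banach space. Then $X$ has the fixed point property for $\mathfrak{cm}$-nonexpansive maps: for every nonempty bounded closed convex $C\subset X$, every $\mathfrak{cm}$-nonexpansive map $T\colon C\to C$ has a fixed point.
   Context: $X$ is super-reflexive if every Banach space finitely representable in $X$ is reflexive. For a bounded convex set $C$, a nonexpansive map $T\colon C\to C$ is $\mathfrak{cm}$-nonexpansive if for all $n\in\mathbb{N}$, $y\in C$ and sequences $(u_i)_{i=1}^\infty\subset C$: $\limsup_{i\to\infty}\sup_{A\subset\{1,\dots,n\}}\|\sum_{k\in A}(Tu_{i+k}-Ty)\|\le\limsup_{i\to\infty}\sup_{A\subset\{1,\dots,n\}}\|\sum_{k\in A}(u_{i+k}-y)\|$. *)

theory Defs
  imports "HOL-Analysis.Analysis"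
begin

text \<open>Abstract (separable-size) Banach spaces are modelled as a linear subspace V of
  the real vector space nat => real (pointwise operations) together with a norm N on V.\<close>

type_synonym seqv = "nat \<Rightarrow> real"

definition vadd :: "seqv \<Rightarrow> seqv \<Rightarrow> seqv" where
  "vadd x y = (\<lambda>n. x n + y n)"

definition vscale :: "real \<Rightarrow> seqv \<Rightarrow> seqv" where
  "vscale a x = (\<lambda>n. a * x n)"

definition vzero :: seqv where
  "vzero = (\<lambda>n. 0)"

definition vdiff :: "seqv \<Rightarrow> seqv \<Rightarrow> seqv" where
  "vdiff x y = (\<lambda>n. x n - y n)"

definition normed_subspace :: "seqv set \<Rightarrow> (seqv \<Rightarrow> real) \<Rightarrow> bool" where
  "normed_subspace V N \<longleftrightarrow>
     vzero \<in> V \<and>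
     (\<forall>x\<in>V. \<forall>y\<in>V. vadd x y \<in> V) \<and>
     (\<forall>a. \<forall>x\<in>V. vscale a x \<in> V) \<and>
     (\<forall>x\<in>V. 0 \<le> N x \<and> (N x = 0 \<longleftrightarrow> x = vzero)) \<and>
     (\<forall>a. \<forall>x\<in>V. N (vscale a x) = \<bar>a\<bar> * N x) \<and>
     (\<forall>x\<in>V. \<forall>y\<in>V. N (vadd x y) \<le> N x + N y)"

definition banach_subspace :: "seqv set \<Rightarrow> (seqv \<Rightarrow> real) \<Rightarrow> bool" where
  "banach_subspace V N \<longleftrightarrow> normed_subspace V N \<and>
     (\<forall>x :: nat \<Rightarrow> seqv. (\<forall>i. x i \<in> V) \<longrightarrow>
        (\<forall>e>0. \<exists>M. \<forall>m\<ge>M. \<forall>n\<ge>M. N (vdiff (x m) (x n)) < e) \<longrightarrow>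
        (\<exists>y\<in>V. \<forall>e>0. \<exists>M. \<forall>n\<ge>M. N (vdiff (x n) y) < e))"

definition dual_space :: "seqv set \<Rightarrow> (seqv \<Rightarrow> real) \<Rightarrow> (seqv \<Rightarrow> real) set" where
  "dual_space V N = {f. (\<forall>x. x \<notin> V \<longrightarrow> f x = 0) \<and>
      (\<forall>a. \<forall>x\<in>V. \<forall>y\<in>V. f (vadd (vscale a x) y) = a * f x + f y) \<and>
      (\<exists>B. \<forall>x\<in>V. \<bar>f x\<bar> \<le> B * N x)}"

definition dual_norm :: "seqv set \<Rightarrow> (seqv \<Rightarrow> real) \<Rightarrow> (seqv \<Rightarrow> real) \<Rightarrow> real" where
  "dual_norm V N f = Sup {\<bar>f x\<bar> | x. x \<in> V \<and> N x \<le> 1}"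

definition reflexive_space :: "seqv set \<Rightarrow> (seqv \<Rightarrow> real) \<Rightarrow> bool" where
  "reflexive_space V N \<longleftrightarrow>
     (\<forall>\<Phi> :: (seqv \<Rightarrow> real) \<Rightarrow> real.
        ((\<forall>a. \<forall>f\<in>dual_space V N. \<forall>g\<in>dual_space V N.
            \<Phi> (\<lambda>x. a * f x + g x) = a * \<Phi> f + \<Phi> g) \<and>
         (\<exists>B. \<forall>f\<in>dual_space V N. \<bar>\<Phi> f\<bar> \<le> B * dual_norm V N f))
        \<longrightarrow> (\<exists>x\<in>V. \<forall>f\<in>dual_space V N. \<Phi> f = f x))"

definition fin_span :: "seqv set \<Rightarrow> seqv set" where
  "fin_span S = {(\<lambda>n. \<Sum>s\<in>S. c s * s n) | c. True}"

definition fin_representable :: "seqv set \<Rightarrow> (seqv \<Rightarrow> real) \<Rightarrow> 'a::real_normed_vector itself \<Rightarrow> bool" where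
  "fin_representable V N _ \<longleftrightarrow>
     (\<forall>S. finite S \<and> S \<subseteq> V \<longrightarrow> (\<forall>e>0. \<exists>J :: seqv \<Rightarrow> 'a.
        (\<forall>a. \<forall>x\<in>fin_span S. \<forall>y\<in>fin_span S. J (vadd (vscale a x) y) = a *\<^sub>R J x + J y) \<and>
        (\<forall>y\<in>fin_span S. N y \<le> norm (J y) \<and> norm (J y) \<le> (1 + e) * N y)))"

definition super_reflexive :: "'a::banach itself \<Rightarrow> bool" where
  "super_reflexive X \<longleftrightarrow>
     (\<forall>V N. banach_subspace V N \<and> fin_representable V N X \<longrightarrow> reflexive_space V N)"

definition cm_nonexpansive :: "'a::real_normed_vector set \<Rightarrow> ('a \<Rightarrow> 'a) \<Rightarrow> bool" where
  "cm_nonexpansive C T \<longleftrightarrow>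
     T ` C \<subseteq> C \<and>
     (\<forall>x\<in>C. \<forall>y\<in>C. norm (T x - T y) \<le> norm (x - y)) \<and>
     (\<forall>(n::nat). \<forall>y\<in>C. \<forall>u :: nat \<Rightarrow> 'a. range u \<subseteq> C \<longrightarrow>
        limsup (\<lambda>i. ereal (Max ((\<lambda>A. norm (\<Sum>k\<in>A. T (u (i + k)) - T y)) ` Pow {1..n})))
        \<le> limsup (\<lambda>i. ereal (Max ((\<lambda>A. norm (\<Sum>k\<in>A. u (i + k) - y)) ` Pow {1..n}))))"

end

theory Submission
  imports Defs
begin

text \<open>
  Let u be a sequence of approximate fixed points in C.  Iterating a generalised limit of
  the norms of \<open>x + a 0 *\<^sub>R u i\<^sub>0 + \<dots> + a (n - 1) *\<^sub>R u i\<^sub>n\<^sub>-\<^sub>1\<close> gives a spreading model of u over X.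
  Either some point has arbitrarily small distance to the averages of the first n unit vectors
  of the spreading model, or these averages stay uniformly away from X.

  In the second case spreading invariance makes the unit vectors a basic sequence on which the
  summing functional is bounded.  Their closed span is then a non-reflexive Banach space of
  scalar sequences which is finitely representable in X, contradicting super-reflexivity.

  In the first case there is y in C such that, along a suitable sequence v built from u, all sums
  of \<open>v (i + k) - y\<close> over subsets of a window of length n have norm at most \<open>\<epsilon> n\<close>.  The defining
  inequality of cm-nonexpansive maps passes this bound on to T y, and two such points must coincide.
\<close>

section \<open>Iterated limits of norms\<close>

text \<open>Once the indices of the late coordinates are fixed, these coordinates merely shift the
  base point \<open>x\<close> of the iterated norm \<open>P n a x\<close>. Averages staying away
  from X give exactly this: by spreading invariance a vector may be replaced by its total mass
  spread over very many coordinates, at a vanishing cost in norm, and for spread-out vectors the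
  hypothesis on averages applies. Both the summing functional and the basis property come from this
  one observation.

  The limit functional is fixed once for all bounded sequences. So no subsequences are extracted,
  and spreading invariance holds exactly because a zero coefficient leaves a constant sequence.

  On the other side, cm-nonexpansiveness speaks of windows of consecutive terms of one sequence,
  whereas small sums are found only for separately chosen tuples of terms. Laying such tuples end to
  end overcomes this at the cost of a factor 2.\<close>

lemma cluster_functional_exists:
  "\<exists>L :: (nat \<Rightarrow> real) \<Rightarrow> real. \<forall>F d j. finite F \<longrightarrow> (\<forall>f\<in>F. bounded (range f)) \<longrightarrow> d > 0 \<longrightarrow>
     (\<exists>i\<ge>j. \<forall>f\<in>F. \<bar>f i - L f\<bar> < d)"
proof -
  have "\<exists>b. \<forall>f::nat \<Rightarrow> real. bounded (range f) \<longrightarrow> (\<forall>i. \<bar>f i\<bar> \<le> b f)"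
    by (rule choice) (auto simp: bounded_iff)
  then obtain b where b: "\<And>(f::nat \<Rightarrow> real) i. bounded (range f) \<Longrightarrow> \<bar>f i\<bar> \<le> b f"
    by blast
  define ev :: "nat \<Rightarrow> (nat \<Rightarrow> real) \<Rightarrow> real"
    where "ev i f = (if bounded (range f) then f i else 0)" for i f
  \<comment> \<open>By Tychonoff the evaluations lie in a compact product of intervals, and
    \<open>L\<close> is one of their cluster points. The value 0 at unbounded sequences keeps
    \<open>ev i\<close> in \<open>K\<close> whatever \<open>b\<close> is there.\<close>
  define K where "K = PiE UNIV (\<lambda>f. {-\<bar>b f\<bar>..\<bar>b f\<bar>})"
  have "compactin (product_topology (\<lambda>i::nat \<Rightarrow> real. euclidean::real topology) UNIV) K"
    by (simp add: K_def compactin_PiE)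
  then have "compact K"
    by (simp add: euclidean_product_topology)
  have evK: "ev i \<in> K" for i
  proof -
    have "f i \<le> \<bar>b f\<bar> \<and> -\<bar>b f\<bar> \<le> f i" if "bounded (range f)" for f
      using b[OF that, of i] by linarith
    then show ?thesis by (auto simp: K_def ev_def)
  qed
  define F where "F = filtermap ev sequentially"
  have "F \<noteq> bot" by (simp add: F_def filtermap_bot_iff)
  moreover have "eventually (\<lambda>x. x \<in> K) F"
    by (simp add: F_def eventually_filtermap evK)
  ultimately obtain L where L: "inf (nhds L) F \<noteq> bot"
    using \<open>compact K\<close> unfolding compact_filter by blast
  have "\<exists>i\<ge>j. \<forall>f\<in>A. \<bar>f i - L f\<bar> < d"
    if A: "finite A" "\<forall>f\<in>A. bounded (range f)" "d > 0" for A and d :: real and j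
  proof -
    \<comment> \<open>A basic neighbourhood of \<open>L\<close> restricts finitely many sequences at
      once. Hence one large index serves all of them, and limit laws follow from identities at that
      index.\<close>
    let ?W = "{g. \<forall>f\<in>A. g f \<in> ball (L f) d}"
    have "open ?W"
      by (rule product_topology_basis'[where x = "\<lambda>f. f"]) (auto simp: A)
    then have "eventually (\<lambda>g. g \<in> ?W) (nhds L)"
      using \<open>d > 0\<close> by (intro eventually_nhds_in_open) auto
    moreover have "eventually (\<lambda>g. g \<in> ev ` {j..}) F"
      unfolding F_def eventually_filtermap by (rule eventually_sequentiallyI[of j]) auto
    ultimately have "eventually (\<lambda>g. g \<in> ?W \<and> g \<in> ev ` {j..}) (inf (nhds L) F)"
      unfolding eventually_inf by blast
    then obtain g where "g \<in> ?W" "g \<in> ev ` {j..}"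
      using eventually_happens'[OF L] by blast
    then show ?thesis using A(2)
      by (auto simp: ev_def dist_real_def abs_minus_commute)
  qed
  then show ?thesis by blast
qed

definition clim :: "(nat \<Rightarrow> real) \<Rightarrow> real" where
  "clim = (SOME L. \<forall>F d j. finite F \<longrightarrow> (\<forall>f\<in>F. bounded (range f)) \<longrightarrow> d > 0 \<longrightarrow>
     (\<exists>i\<ge>j. \<forall>f\<in>F. \<bar>f i - L f\<bar> < d))"

lemma clim_approx:
  assumes "finite F" "\<And>f. f \<in> F \<Longrightarrow> bounded (range f)" "d > 0"
  shows "\<exists>i\<ge>j. \<forall>f\<in>F. \<bar>f i - clim f\<bar> < d"
  by (rule someI_ex[OF cluster_functional_exists, folded clim_def, rule_format])
     (use assms in auto)

lemma clim_ge:
  assumes "bounded (range f)" "\<And>i. i \<ge> j \<Longrightarrow> c \<le> f i"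
  shows "c \<le> clim f"
proof (rule field_le_epsilon)
  fix e :: real assume "e > 0"
  then obtain i where "i \<ge> j" "\<bar>f i - clim f\<bar> < e"
    using clim_approx[of "{f}" e j] assms(1) by auto
  then show "c \<le> clim f + e" using assms(2)[of i] by linarith
qed

lemma clim_le:
  assumes "bounded (range f)" "\<And>i. i \<ge> j \<Longrightarrow> f i \<le> c"
  shows "clim f \<le> c"
proof (rule field_le_epsilon)
  fix e :: real assume "e > 0"
  then obtain i where "i \<ge> j" "\<bar>f i - clim f\<bar> < e"
    using clim_approx[of "{f}" e j] assms(1) by auto
  then show "clim f \<le> c + e" using assms(2)[of i] by linarith
qed

lemma clim_eventually_const:
  assumes "\<And>i. i \<ge> j \<Longrightarrow> f i = c"
  shows "clim f = c"
proof -
  have "bounded (f ` ({..<j} \<union> {j..}))"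
  proof -
    have "f ` {j..} \<subseteq> {c}" using assms by auto
    then show ?thesis
      unfolding image_Un bounded_Un
      by (auto intro: finite_imp_bounded bounded_subset[of "{c}"])
  qed
  then have "bounded (range f)"
    by (rule bounded_subset) (auto simp: not_le)
  then show ?thesis
    using clim_ge[of f j c] clim_le[of f j c] assms by (intro antisym) auto
qed

lemma clim_const [simp]: "clim (\<lambda>_. c) = c"
  by (rule clim_eventually_const) simp

lemma clim_linear:
  assumes "bounded (range f)" "bounded (range g)"
  shows "clim (\<lambda>i. a * f i + g i) = a * clim f + clim g"
proof -
  let ?h = "\<lambda>i. a * f i + g i"
  obtain A B where "\<And>i. \<bar>f i\<bar> \<le> A" "\<And>i. \<bar>g i\<bar> \<le> B"
    using assms by (auto simp: bounded_iff)
  then have "\<bar>?h i\<bar> \<le> \<bar>a\<bar> * A + B" for i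
    by (metis abs_mult abs_triangle_ineq add_mono mult_left_mono abs_ge_zero order_trans)
  then have bh: "bounded (range ?h)"
    by (auto simp: bounded_iff)
  have "\<bar>clim ?h - (a * clim f + clim g)\<bar> \<le> 0 + e" if "e > 0" for e :: real
  proof -
    \<comment> \<open>Three errors, one of them multiplied by the absolute value of
      \<open>a\<close>, have to add up to \<open>e\<close>.\<close>
    define d where "d = e / (2 + \<bar>a\<bar>)"
    have "d > 0" using that by (simp add: d_def)
    then obtain i where i: "\<And>k. k \<in> {f, g, ?h} \<Longrightarrow> \<bar>k i - clim k\<bar> < d"
      using clim_approx[of "{f, g, ?h}" d 0] assms bh by auto
    have "\<bar>clim ?h - (a * clim f + clim g)\<bar>
        = \<bar>a * (f i - clim f) + (g i - clim g) - (?h i - clim ?h)\<bar>"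
      by (simp add: algebra_simps)
    also have "\<dots> \<le> \<bar>a\<bar> * \<bar>f i - clim f\<bar> + \<bar>g i - clim g\<bar> + \<bar>?h i - clim ?h\<bar>"
      unfolding abs_mult[symmetric] by linarith
    also have "\<dots> \<le> \<bar>a\<bar> * d + d + d"
      using i[of f] i[of g] i[of ?h] by (intro add_mono mult_left_mono) auto
    also have "\<dots> = d * (2 + \<bar>a\<bar>)" by (simp add: algebra_simps)
    also have "\<dots> = e" by (simp add: d_def)
    finally show ?thesis by simp
  qed
  then have "\<bar>clim ?h - (a * clim f + clim g)\<bar> \<le> 0"
    by (rule field_le_epsilon) auto
  then show ?thesis by simp
qed

text \<open>The last coordinate belongs to the outermost limit, so in approximations the indices
  are chosen from the last coordinate down to the first.\<close>

primrec iter_norm :: "(nat \<Rightarrow> 'a::real_normed_vector) \<Rightarrow> nat \<Rightarrow> (nat \<Rightarrow> real) \<Rightarrow> 'a \<Rightarrow> real" where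
  "iter_norm u 0 a x = norm x"
| "iter_norm u (Suc n) a x = clim (\<lambda>i. iter_norm u n a (x + a n *\<^sub>R u i))"

locale bounded_sequence =
  fixes u :: "nat \<Rightarrow> 'a::real_normed_vector" and M :: real
  assumes norm_le: "\<And>i. norm (u i) \<le> M" and M_pos: "M > 0"
begin

abbreviation P :: "nat \<Rightarrow> (nat \<Rightarrow> real) \<Rightarrow> 'a \<Rightarrow> real" where
  "P \<equiv> iter_norm u"

lemma P_bounds: "0 \<le> P n a x \<and> P n a x \<le> norm x + M * (\<Sum>k<n. \<bar>a k\<bar>)"
proof (induction n arbitrary: x)
  case (Suc n)
  have le: "P n a (x + a n *\<^sub>R u i) \<le> norm x + M * (\<Sum>k<Suc n. \<bar>a k\<bar>)" for i
  proof -
    have "norm (x + a n *\<^sub>R u i) \<le> norm x + \<bar>a n\<bar> * M"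
      using norm_triangle_ineq[of x "a n *\<^sub>R u i"] mult_left_mono[OF norm_le[of i], of "\<bar>a n\<bar>"]
      by simp
    then show ?thesis
      using Suc[of "x + a n *\<^sub>R u i"] by (simp add: algebra_simps)
  qed
  have "bounded (range (\<lambda>i. P n a (x + a n *\<^sub>R u i)))"
    unfolding bounded_iff using le Suc
    by (intro exI[of _ "norm x + M * (\<Sum>k<Suc n. \<bar>a k\<bar>)"]) auto
  from clim_ge[OF this, of 0 0] clim_le[OF this le] show ?case
    using Suc by simp
qed simp

lemma P_nonneg [simp]: "0 \<le> P n a x"
  using P_bounds by blast

lemma P_le: "P n a x \<le> norm x + M * (\<Sum>k<n. \<bar>a k\<bar>)"
  using P_bounds by blast

lemma P_step_bounded: "bounded (range (\<lambda>i. P n a (x + c *\<^sub>R u i)))"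
proof -
  have "P n a (x + c *\<^sub>R u i) \<le> norm x + \<bar>c\<bar> * M + M * (\<Sum>k<n. \<bar>a k\<bar>)" for i
    using norm_triangle_ineq[of x "c *\<^sub>R u i"] mult_left_mono[OF norm_le[of i], of "\<bar>c\<bar>"]
      P_le[of n a "x + c *\<^sub>R u i"]
    unfolding norm_scaleR by linarith
  then have "\<forall>i. norm (P n a (x + c *\<^sub>R u i)) \<le> norm x + \<bar>c\<bar> * M + M * (\<Sum>k<n. \<bar>a k\<bar>)"
    by (simp only: real_norm_def abs_of_nonneg P_nonneg) blast
  then show ?thesis
    unfolding bounded_iff by blast
qed

text \<open>Transfers finitely many facts about norms in X to \<open>P\<close> by means of one tuple
  of indices. Apart from being at least \<open>j\<close> the indices are unrestricted: neither their
  order nor their distinctness matters later.\<close>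

lemma P_approx:
  assumes "finite Q" "d > 0"
  shows "\<exists>i. (\<forall>k. i k \<ge> j) \<and>
     (\<forall>(a, x)\<in>Q. \<bar>norm (x + (\<Sum>k<n. a k *\<^sub>R u (i k))) - P n a x\<bar> < d)"
  using assms
proof (induction n arbitrary: Q d)
  case 0
  show ?case
    by (intro exI[of _ "\<lambda>_. j"]) (use 0 in auto)
next
  case (Suc n)
  let ?F = "(\<lambda>(a, x) i. P n a (x + a n *\<^sub>R u i)) ` Q"
  have F: "finite ?F" "d / 2 > 0"
    using Suc.prems by simp_all
  have bdd: "bounded (range f)" if "f \<in> ?F" for f
    using that by (auto simp: P_step_bounded)
  obtain l where l: "l \<ge> j" "\<And>f. f \<in> ?F \<Longrightarrow> \<bar>f l - clim f\<bar> < d / 2"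
    using clim_approx[OF F(1) bdd F(2), of j] by blast
  obtain i where i: "\<forall>k. i k \<ge> j"
    "\<forall>(a, x)\<in>(\<lambda>(a, x). (a, x + a n *\<^sub>R u l)) ` Q.
       \<bar>norm (x + (\<Sum>k<n. a k *\<^sub>R u (i k))) - P n a x\<bar> < d / 2"
    using Suc.IH[of "(\<lambda>(a, x). (a, x + a n *\<^sub>R u l)) ` Q" "d / 2"] Suc.prems by auto
  show ?case
  proof (intro exI[of _ "i(n := l)"] conjI ballI)
    show "\<forall>k. (i(n := l)) k \<ge> j" using i(1) l(1) by simp
    fix p assume "p \<in> Q"
    obtain a x where p: "p = (a, x)" by force
    have "\<bar>P n a (x + a n *\<^sub>R u l) - P (Suc n) a x\<bar> < d / 2"
      using l(2)[of "\<lambda>i. P n a (x + a n *\<^sub>R u i)"] \<open>p \<in> Q\<close> p by force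
    moreover have "\<bar>norm (x + a n *\<^sub>R u l + (\<Sum>k<n. a k *\<^sub>R u (i k))) - P n a (x + a n *\<^sub>R u l)\<bar> < d / 2"
      using i(2) \<open>p \<in> Q\<close> p by force
    moreover have eq: "x + (\<Sum>k<Suc n. a k *\<^sub>R u ((i(n := l)) k))
        = x + a n *\<^sub>R u l + (\<Sum>k<n. a k *\<^sub>R u (i k))"
      by simp
    ultimately show "case p of (a, x) \<Rightarrow>
        \<bar>norm (x + (\<Sum>k<Suc n. a k *\<^sub>R u ((i(n := l)) k))) - P (Suc n) a x\<bar> < d"
      unfolding p prod.case eq by linarith
  qed
qed

lemma P_triangle: "P n (\<lambda>k. a k + b k) (x + y) \<le> P n a x + P n b y"
proof (rule field_le_epsilon)
  fix e :: real assume "e > 0"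
  then obtain i where i: "\<forall>(a, x)\<in>{(a, x), (b, y), (\<lambda>k. a k + b k, x + y)}.
      \<bar>norm (x + (\<Sum>k<n. a k *\<^sub>R u (i k))) - P n a x\<bar> < e / 3"
    using P_approx[of "{(a, x), (b, y), (\<lambda>k. a k + b k, x + y)}" "e / 3" 0 n] by auto
  have "norm (x + y + (\<Sum>k<n. (a k + b k) *\<^sub>R u (i k)))
      \<le> norm (x + (\<Sum>k<n. a k *\<^sub>R u (i k))) + norm (y + (\<Sum>k<n. b k *\<^sub>R u (i k)))"
    by (rule order_trans[OF _ norm_triangle_ineq])
       (simp add: scaleR_left_distrib sum.distrib algebra_simps)
  then show "P n (\<lambda>k. a k + b k) (x + y) \<le> P n a x + P n b y + e"
    using i by (simp only: ball_simps prod.case, elim conjE) linarith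
qed

lemma P_scale: "P n (\<lambda>k. c * a k) (c *\<^sub>R x) = \<bar>c\<bar> * P n a x"
proof -
  have "\<bar>P n (\<lambda>k. c * a k) (c *\<^sub>R x) - \<bar>c\<bar> * P n a x\<bar> \<le> 0 + e" if "e > 0" for e
  proof -
    define d where "d = e / (1 + \<bar>c\<bar>)"
    have "d > 0" using that by (simp add: d_def)
    then obtain i where i: "\<forall>(a, x)\<in>{(a, x), (\<lambda>k. c * a k, c *\<^sub>R x)}.
        \<bar>norm (x + (\<Sum>k<n. a k *\<^sub>R u (i k))) - P n a x\<bar> < d"
      using P_approx[of "{(a, x), (\<lambda>k. c * a k, c *\<^sub>R x)}" d 0 n] by auto
    let ?v = "x + (\<Sum>k<n. a k *\<^sub>R u (i k))"
    have "c *\<^sub>R x + (\<Sum>k<n. (c * a k) *\<^sub>R u (i k)) = c *\<^sub>R ?v"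
      by (simp add: scaleR_right_distrib scaleR_sum_right)
    then have "\<bar>\<bar>c\<bar> * norm ?v - P n (\<lambda>k. c * a k) (c *\<^sub>R x)\<bar> < d"
      using i by auto
    moreover have "\<bar>\<bar>c\<bar> * norm ?v - \<bar>c\<bar> * P n a x\<bar> \<le> \<bar>c\<bar> * d"
      using i by (auto simp: right_diff_distrib[symmetric] abs_mult intro!: mult_left_mono)
    moreover have "d * (1 + \<bar>c\<bar>) = e" by (simp add: d_def)
    then have "d + \<bar>c\<bar> * d = e" by (simp add: algebra_simps)
    ultimately show ?thesis by linarith
  qed
  then have "\<bar>P n (\<lambda>k. c * a k) (c *\<^sub>R x) - \<bar>c\<bar> * P n a x\<bar> \<le> 0"
    by (rule field_le_epsilon) auto
  then show ?thesis by simp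
qed

lemma P_cong: "(\<And>k. k < n \<Longrightarrow> a k = b k) \<Longrightarrow> P n a x = P n b x"
proof (induction n arbitrary: x)
  case (Suc n)
  then have "P n a y = P n b y" "a n = b n" for y
    by simp_all
  then show ?case by simp
qed simp

lemma P_triangle_arg: "P n a (x + y) \<le> P n a x + norm y"
proof -
  have "P n (\<lambda>k. a k + 0) (x + y) \<le> P n a x + P n (\<lambda>_. 0) y"
    by (rule P_triangle)
  then show ?thesis using P_le[of n "\<lambda>_. 0" y] by simp
qed

lemma P_triangle_coeff: "P n b x \<le> P n a x + M * (\<Sum>k<n. \<bar>b k - a k\<bar>)"
proof -
  have "P n (\<lambda>k. a k + (b k - a k)) (x + 0) \<le> P n a x + P n (\<lambda>k. b k - a k) 0"
    by (rule P_triangle)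
  then show ?thesis using P_le[of n "\<lambda>k. b k - a k" 0] by simp
qed

lemma P_uminus: "P n (\<lambda>k. - a k) (- x) = P n a x"
  using P_scale[of n "-1" a x] by simp

text \<open>A zero coefficient turns its limit into that of a constant sequence, so the coordinate
  leaves no trace. All spreading invariance below rests on this.\<close>

lemma P_zero_coeff: "n \<le> n' \<Longrightarrow> (\<And>k. n \<le> k \<Longrightarrow> k < n' \<Longrightarrow> a k = 0) \<Longrightarrow> P n' a x = P n a x"
proof (induction n' rule: dec_induct)
  case (step m)
  then show ?case by simp
qed simp

lemma P_shift: "P (j + n) (\<lambda>l. if l < j then 0 else a (l - j)) x = P n a x"
proof (induction n arbitrary: x)
  case 0
  show ?case using P_zero_coeff[of 0 j] by simp
qed simp

text \<open>Gaps between coordinates are invisible, so only the cardinality counts. This lets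
  \<open>G\<close> control the sums over all subsets of a block.\<close>

lemma P_indicator: "P n (\<lambda>k. if k \<in> A then 1 else 0) x = P (card (A \<inter> {..<n})) (\<lambda>_. 1) x"
proof (induction n arbitrary: x)
  case (Suc n)
  show ?case
  proof (cases "n \<in> A")
    case True
    then have "A \<inter> {..<Suc n} = insert n (A \<inter> {..<n})" by auto
    then show ?thesis using True Suc by simp
  next
    case False
    then have "A \<inter> {..<Suc n} = A \<inter> {..<n}" by (auto simp: less_Suc_eq)
    then show ?thesis using False Suc by simp
  qed
qed simp

text \<open>Each further limit only moves the base point within the space, so a lower bound uniform
  in \<open>y\<close> survives it. This is the device for discarding the coordinates from
  \<open>m\<close> on.\<close>

lemma P_ge_inf:
  assumes "\<And>y. c \<le> P m a y" "m \<le> n"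
  shows "c \<le> P n a x"
  using assms(2)
proof (induction n arbitrary: x rule: dec_induct)
  case (step k)
  then show ?case using clim_ge[OF P_step_bounded, of 0 c] by simp
qed (rule assms(1))

lemma P_zero [simp]: "P n (\<lambda>_. 0) x = norm x"
  using P_zero_coeff[of 0 n "\<lambda>_. 0" x] by simp

text \<open>Spreading invariance moves the second vector behind the first without changing its norm;
  then the triangle inequality applies. The purpose is the subadditivity of \<open>G\<close> in
  \<open>n\<close>.\<close>

lemma P_append: "P (m + n) (\<lambda>k. if k < m then a k else b (k - m)) (x + y) \<le> P m a x + P n b y"
proof -
  let ?a = "\<lambda>k. if k < m then a k else 0" and ?b = "\<lambda>k. if k < m then 0 else b (k - m)"
  have "P (m + n) (\<lambda>k. ?a k + ?b k) (x + y) \<le> P (m + n) ?a x + P (m + n) ?b y"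
    by (rule P_triangle)
  moreover have "P (m + n) ?a x = P m ?a x"
    by (rule P_zero_coeff) auto
  moreover have "P m ?a x = P m a x"
    by (rule P_cong) auto
  moreover have "(\<lambda>k. ?a k + ?b k) = (\<lambda>k. if k < m then a k else b (k - m))"
    by auto
  ultimately show ?thesis by (simp only: P_shift)
qed

section \<open>Averages converging to a point\<close>

text \<open>\<open>G n y / n\<close> is the distance from y to the average of n unit vectors of the spreading model.\<close>

definition G :: "nat \<Rightarrow> 'a \<Rightarrow> real" where
  "G n y = P n (\<lambda>_. 1) (- (real n *\<^sub>R y))"

lemma G_add: "G (m + n) y \<le> G m y + G n y"
  using P_append[of m n "\<lambda>_. 1" "\<lambda>_. 1" "- (real m *\<^sub>R y)" "- (real n *\<^sub>R y)"]
  by (simp add: G_def algebra_simps)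

lemma G_mult: "G (q * n) y \<le> real q * G n y"
proof (induction q)
  case (Suc q)
  then show ?case using G_add[of n "q * n" y] by (simp add: algebra_simps)
qed (simp add: G_def)

lemma G_le: "G n y \<le> real n * (norm y + M)"
  using P_le[of n "\<lambda>_. 1" "- (real n *\<^sub>R y)"] by (simp add: G_def algebra_simps)

lemma G_lipschitz: "G n y \<le> G n z + real n * norm (y - z)"
proof -
  have "- (real n *\<^sub>R z) + real n *\<^sub>R (z - y) = - (real n *\<^sub>R y)"
    by (simp add: algebra_simps)
  then show ?thesis
    using P_triangle_arg[of n "\<lambda>_. 1" "- (real n *\<^sub>R z)" "real n *\<^sub>R (z - y)"]
    by (simp add: G_def norm_minus_commute)
qed

text \<open>The unit vectors cancel in the difference, leaving a vector of the space itself, on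
  which \<open>P\<close> is the norm.\<close>

lemma dist_le_G: "real n * norm (y - z) \<le> G n y + G n z"
proof -
  have "P n (\<lambda>k. 1 + - 1) (- (real n *\<^sub>R y) + - (- (real n *\<^sub>R z))) \<le> G n y + P n (\<lambda>_. - 1) (- (- (real n *\<^sub>R z)))"
    unfolding G_def by (rule P_triangle)
  also have "P n (\<lambda>_. - 1) (- (- (real n *\<^sub>R z))) = G n z"
    unfolding G_def by (rule P_uminus)
  also have "P n (\<lambda>k. 1 + - 1) (- (real n *\<^sub>R y) + - (- (real n *\<^sub>R z))) = norm (real n *\<^sub>R (z - y))"
    by (simp add: algebra_simps)
  finally show ?thesis by (simp add: norm_minus_commute)
qed

text \<open>By subadditivity, division of \<open>m\<close> by \<open>n\<^sub>0\<close> gives slope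
  \<open>e / 2\<close> plus fewer than \<open>n\<^sub>0\<close> leftover terms, and \<open>n\<close>
  is taken so large that these fit into the other half. Short averages need not be good, which is
  why the bound is \<open>e * real n\<close> and not \<open>e * real m\<close>.\<close>

lemma G_small_uniform:
  assumes "n\<^sub>0 > 0" "G n\<^sub>0 y \<le> e / 2 * real n\<^sub>0" "e > 0"
  shows "\<exists>n>0. \<forall>m\<le>n. G m y \<le> e * real n"
proof -
  define B where "B = norm y + M"
  have B: "B > 0" using M_pos by (simp add: B_def add_nonneg_pos)
  obtain n :: nat where n: "2 * real n\<^sub>0 * B / e < real n"
    using reals_Archimedean2 by blast
  moreover have "0 \<le> 2 * real n\<^sub>0 * B / e" using B assms(3) by simp
  ultimately have "n > 0" by (metis gr0I not_le of_nat_0)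
  have nB: "real n\<^sub>0 * B \<le> e / 2 * real n"
    using n assms(3) by (simp add: field_simps)
  have "G m y \<le> e * real n" if "m \<le> n" for m
  proof -
    define q r where "q = m div n\<^sub>0" and "r = m mod n\<^sub>0"
    have m: "m = q * n\<^sub>0 + r" by (simp add: q_def r_def)
    have "r < n\<^sub>0" using assms(1) by (simp add: r_def)
    have "G m y \<le> real q * G n\<^sub>0 y + real r * B"
      unfolding m B_def by (rule order_trans[OF G_add add_mono[OF G_mult G_le]])
    also have "real q * G n\<^sub>0 y \<le> real q * (e / 2 * real n\<^sub>0)"
      using assms(2) by (intro mult_left_mono) auto
    also have "real q * (e / 2 * real n\<^sub>0) = e / 2 * real (q * n\<^sub>0)"
      by simp
    also have "\<dots> \<le> e / 2 * real n"
      using that m assms(3) by (intro mult_left_mono of_nat_mono) auto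
    also have "real r * B \<le> real n\<^sub>0 * B"
      using \<open>r < n\<^sub>0\<close> B by (intro mult_right_mono) auto
    finally show ?thesis using nB by linarith
  qed
  with \<open>n > 0\<close> show ?thesis by blast
qed

text \<open>Any two points which are e-close to block averages are 2e-close to each other (compare
  both along a common multiple of the two block lengths), so better and better approximate
  means form a Cauchy sequence.\<close>

lemma mean_point_exists:
  assumes "complete (UNIV :: 'a set)"
    and small: "\<And>e. e > 0 \<Longrightarrow> \<exists>n>0. \<exists>y. G n y \<le> e * real n"
  shows "\<exists>y. \<forall>e>0. \<exists>n>0. G n y \<le> e * real n"
proof -
  have "\<exists>p. fst p > 0 \<and> G (fst p) (snd p) \<le> inverse (real (Suc j)) * real (fst p)" for j
    using small[of "inverse (real (Suc j))"] by auto
  then obtain p where p: "\<And>j. fst (p j) > 0 \<and> G (fst (p j)) (snd (p j)) \<le> inverse (real (Suc j)) * real (fst (p j))"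
    by metis
  define n y where "n j = fst (p j)" and "y j = snd (p j)" for j
  have n: "n j > 0" and G: "G (n j) (y j) \<le> inverse (real (Suc j)) * real (n j)" for j
    using p[of j] by (auto simp: n_def y_def)
  have dist: "norm (y j - y l) \<le> inverse (real (Suc j)) + inverse (real (Suc l))" for j l
  proof -
    have "real (n j * n l) * norm (y j - y l) \<le> G (n l * n j) (y j) + G (n j * n l) (y l)"
      using dist_le_G[of "n j * n l" "y j" "y l"] by (simp add: mult.commute)
    also have "\<dots> \<le> real (n l) * G (n j) (y j) + real (n j) * G (n l) (y l)"
      by (intro add_mono G_mult)
    also have "\<dots> \<le> real (n l) * (inverse (real (Suc j)) * real (n j)) + real (n j) * (inverse (real (Suc l)) * real (n l))"
      by (intro add_mono mult_left_mono G) auto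
    also have "\<dots> = real (n j * n l) * (inverse (real (Suc j)) + inverse (real (Suc l)))"
      by (simp add: algebra_simps)
    finally show ?thesis
      using n[of j] n[of l] by (simp only: mult_le_cancel_left) auto
  qed
  have "Cauchy y"
  proof (rule metric_CauchyI)
    fix e :: real assume "e > 0"
    then obtain N where N: "inverse (real (Suc N)) < e / 2"
      using reals_Archimedean[of "e / 2"] by auto
    have "dist (y j) (y l) < e" if "j \<ge> N" "l \<ge> N" for j l
    proof -
      have "inverse (real (Suc j)) \<le> inverse (real (Suc N))" "inverse (real (Suc l)) \<le> inverse (real (Suc N))"
        using that by (auto simp: field_simps)
      then show ?thesis using dist[of j l] N unfolding dist_norm by linarith
    qed
    then show "\<exists>N. \<forall>j\<ge>N. \<forall>l\<ge>N. dist (y j) (y l) < e" by blast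
  qed
  then obtain z where z: "y \<longlonglongrightarrow> z"
    using assms(1) unfolding complete_def by blast
  have "\<exists>n>0. G n z \<le> e * real n" if "e > 0" for e :: real
  proof -
    have "\<forall>\<^sub>F j in sequentially. inverse (real (Suc j)) < e / 2"
      using LIMSEQ_inverse_real_of_nat that by (rule_tac order_tendstoD(2)) auto
    moreover have "\<forall>\<^sub>F j in sequentially. dist (y j) z < e / 2"
      using z that by (intro tendstoD) auto
    ultimately have "\<forall>\<^sub>F j in sequentially. inverse (real (Suc j)) < e / 2 \<and> dist (y j) z < e / 2"
      by (rule eventually_conj)
    then obtain j where j: "inverse (real (Suc j)) < e / 2" "dist (y j) z < e / 2"
      using eventually_happens'[OF sequentially_bot] by blast
    have "G (n j) z \<le> G (n j) (y j) + real (n j) * norm (z - y j)"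
      by (rule G_lipschitz)
    also have "\<dots> \<le> e / 2 * real (n j) + real (n j) * (e / 2)"
      using j by (intro add_mono mult_left_mono order_trans[OF G] mult_right_mono)
         (auto simp: dist_norm norm_minus_commute)
    finally show ?thesis using n[of j] by (auto simp: algebra_simps)
  qed
  then show ?thesis by blast
qed

text \<open>Up to a small error, \<open>G n y / n\<close> is the distance from \<open>y\<close> to
  the mean of suitable \<open>n\<close> terms of \<open>u\<close>, and that mean lies in
  \<open>C\<close> by convexity.\<close>

lemma mean_point_in_closed_convex:
  assumes C: "closed C" "convex C" "range u \<subseteq> C"
    and small: "\<And>e. e > 0 \<Longrightarrow> \<exists>n>0. G n y \<le> e * real n"
  shows "y \<in> C"
proof -
  have "\<exists>w\<in>C. dist w y < e" if e: "e > 0" for e :: real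
  proof -
    obtain n where n: "n > 0" "G n y \<le> e / 3 * real n"
      using small[of "e / 3"] e by auto
    obtain i where i: "\<bar>norm (- (real n *\<^sub>R y) + (\<Sum>k<n. 1 *\<^sub>R u (i k))) - G n y\<bar> < e / 3"
      using P_approx[of "{(\<lambda>_. 1, - (real n *\<^sub>R y))}" "e / 3" 0 n] e by (auto simp: G_def)
    define w where "w = (\<Sum>k<n. (1 / real n) *\<^sub>R u (i k))"
    have "w \<in> C"
      unfolding w_def using n(1) C by (intro convex_sum) auto
    have "real n *\<^sub>R (w - y) = - (real n *\<^sub>R y) + (\<Sum>k<n. 1 *\<^sub>R u (i k))"
      using n(1) by (simp add: w_def algebra_simps scaleR_sum_right)
    then have "real n * norm (w - y) = norm (- (real n *\<^sub>R y) + (\<Sum>k<n. 1 *\<^sub>R u (i k)))"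
      by (metis norm_scaleR abs_of_nat)
    then have "real n * norm (w - y) < e / 3 + e / 3 * real n"
      using i n(2) by linarith
    also have "\<dots> \<le> e / 3 * real n + e / 3 * real n" using n(1) e by simp
    also have "\<dots> < real n * e" using n(1) e by (simp add: field_simps)
    finally have "norm (w - y) < e" using n(1) by simp
    with \<open>w \<in> C\<close> show ?thesis by (auto simp: dist_norm)
  qed
  then show ?thesis using closed_approachable[OF C(1)] by blast
qed

text \<open>The sum over a subset \<open>A\<close> corresponds to \<open>G (card A) y\<close>, so
  \<open>G_small_uniform\<close> covers all subsets and \<open>P_approx\<close> finds one tuple good
  for all of them. Such tuples are wanted beyond every \<open>j\<close>, to be joined into a
  sequence of indices tending to infinity.\<close>

lemma small_blocks:
  assumes small: "\<And>e. e > 0 \<Longrightarrow> \<exists>n>0. G n y \<le> e * real n" and "e > 0"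
  shows "\<exists>n>0. \<forall>j. \<exists>i. (\<forall>k. i k \<ge> j) \<and>
    (\<forall>A\<subseteq>{..<n}. norm (\<Sum>k\<in>A. u (i k) - y) \<le> e * real n)"
proof -
  obtain n\<^sub>0 where "n\<^sub>0 > 0" "G n\<^sub>0 y \<le> (e / 2) / 2 * real n\<^sub>0"
    using small[of "e / 2 / 2"] assms(2) by auto
  then obtain n where n: "n > 0" "\<And>m. m \<le> n \<Longrightarrow> G m y \<le> e / 2 * real n"
    using G_small_uniform[of n\<^sub>0 y "e / 2"] assms(2) by auto
  have "\<exists>i. (\<forall>k. i k \<ge> j) \<and> (\<forall>A\<subseteq>{..<n}. norm (\<Sum>k\<in>A. u (i k) - y) \<le> e * real n)" for j
  proof -
    \<comment> \<open>One pair for each subset; its base point supplies one copy of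
      \<open>- y\<close> for each chosen term.\<close>
    let ?Q = "(\<lambda>A. (\<lambda>k. if k \<in> A then 1 else 0 :: real, - (real (card A) *\<^sub>R y))) ` Pow {..<n}"
    obtain i where i: "\<forall>k. i k \<ge> j"
      "\<forall>(a, x)\<in>?Q. \<bar>norm (x + (\<Sum>k<n. a k *\<^sub>R u (i k))) - P n a x\<bar> < e / 2"
      using P_approx[of ?Q "e / 2" j n] assms(2) by auto
    have "norm (\<Sum>k\<in>A. u (i k) - y) \<le> e * real n" if A: "A \<subseteq> {..<n}" for A
    proof -
      let ?a = "\<lambda>k. if k \<in> A then 1 else 0 :: real" and ?x = "- (real (card A) *\<^sub>R y)"
      have An: "A \<inter> {..<n} = A" "card A \<le> n"
        using A card_mono[of "{..<n}" A] by auto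
      have "(\<Sum>k<n. ?a k *\<^sub>R u (i k)) = (\<Sum>k<n. if k \<in> A then u (i k) else 0)"
        by (intro sum.cong) auto
      also have "\<dots> = (\<Sum>k\<in>A. u (i k))"
        using sum.inter_restrict[of "{..<n}" "\<lambda>k. u (i k)" A] An by (simp add: Int_commute)
      finally have "(\<Sum>k\<in>A. u (i k) - y) = ?x + (\<Sum>k<n. ?a k *\<^sub>R u (i k))"
        by (simp add: sum_subtractf sum_constant_scaleR)
      moreover have "P n ?a ?x = G (card A) y"
        unfolding P_indicator An G_def ..
      moreover have "\<bar>norm (?x + (\<Sum>k<n. ?a k *\<^sub>R u (i k))) - P n ?a ?x\<bar> < e / 2"
      proof -
        have "(?a, ?x) \<in> ?Q" using A by (intro image_eqI[of _ _ A]) auto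
        from bspec[OF i(2) this] show ?thesis by simp
      qed
      ultimately have "\<bar>norm (\<Sum>k\<in>A. u (i k) - y) - G (card A) y\<bar> < e / 2"
        by (simp only:)
      then have "norm (\<Sum>k\<in>A. u (i k) - y) \<le> e / 2 * real n + e / 2"
        using n(2)[OF An(2)] by linarith
      moreover have "e / 2 \<le> e / 2 * real n" using n(1) assms(2) by simp
      ultimately show ?thesis by simp
    qed
    with i(1) show ?thesis by blast
  qed
  with n(1) show ?thesis by blast
qed

end

section \<open>From small window sums to a fixed point\<close>

text \<open>A window of n consecutive indices meets at most two of the blocks of length n.\<close>

lemma window_sum_le:
  fixes g :: "nat \<Rightarrow> nat \<Rightarrow> 'a::real_normed_vector"
  assumes blocks: "\<And>q A. A \<subseteq> {..<n} \<Longrightarrow> norm (\<Sum>k\<in>A. g q k) \<le> c"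
    and n: "n > 0" and A: "A \<subseteq> {1..n}"
  shows "norm (\<Sum>k\<in>A. g ((i + k) div n) ((i + k) mod n)) \<le> 2 * c"
proof -
  have "finite A" using A finite_subset by blast
  define q where "q = (i + 1) div n"
  define B where "B r = {k \<in> A. (i + k) div n = r}" for r
  have part: "norm (\<Sum>k\<in>B r. g ((i + k) div n) ((i + k) mod n)) \<le> c" for r
  proof -
    have inj: "inj_on (\<lambda>k. (i + k) mod n) (B r)"
    proof (rule inj_onI)
      fix k l assume "k \<in> B r" "l \<in> B r" "(i + k) mod n = (i + l) mod n"
      then have "i + k = i + l"
        using div_mult_mod_eq[of "i + k" n] div_mult_mod_eq[of "i + l" n] by (simp add: B_def)
      then show "k = l" by simp
    qed
    have "(\<Sum>k\<in>B r. g ((i + k) div n) ((i + k) mod n)) = (\<Sum>k\<in>B r. g r ((i + k) mod n))"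
      by (rule sum.cong) (auto simp: B_def)
    also have "\<dots> = (\<Sum>k\<in>(\<lambda>k. (i + k) mod n) ` B r. g r k)"
      by (simp add: sum.reindex[OF inj])
    finally show ?thesis
      using blocks[of "(\<lambda>k. (i + k) mod n) ` B r" r] n by (simp add: image_subset_iff)
  qed
  have "A \<subseteq> B q \<union> B (Suc q)"
  proof
    fix k assume "k \<in> A"
    then have k: "1 \<le> k" "k \<le> n" using A by auto
    have "q \<le> (i + k) div n" unfolding q_def using k by (intro div_le_mono) simp
    moreover have "(i + k) div n \<le> (i + 1 + n) div n" using k by (intro div_le_mono) simp
    moreover have "(i + 1 + n) div n = Suc q" using n div_add_self2[of n "i + 1"] by (simp add: q_def)
    ultimately have "(i + k) div n = q \<or> (i + k) div n = Suc q" by linarith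
    then show "k \<in> B q \<union> B (Suc q)" using \<open>k \<in> A\<close> by (auto simp: B_def)
  qed
  then have A_eq: "A = B q \<union> B (Suc q)" by (auto simp: B_def)
  moreover have "B q \<inter> B (Suc q) = {}" by (auto simp: B_def)
  moreover have "finite (B r)" for r using \<open>finite A\<close> by (simp add: B_def)
  ultimately have "(\<Sum>k\<in>A. g ((i + k) div n) ((i + k) mod n)) =
      (\<Sum>k\<in>B q. g ((i + k) div n) ((i + k) mod n)) + (\<Sum>k\<in>B (Suc q). g ((i + k) div n) ((i + k) mod n))"
    by (subst A_eq) (simp add: sum.union_disjoint)
  then show ?thesis
    using norm_triangle_ineq[of "\<Sum>k\<in>B q. g ((i + k) div n) ((i + k) mod n)"
        "\<Sum>k\<in>B (Suc q). g ((i + k) div n) ((i + k) mod n)"] part[of q] part[of "Suc q"] by simp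
qed

text \<open>Up to displacements of \<open>v\<close>, \<open>n\<close> copies of
  \<open>T y - y\<close> are the window sum about \<open>y\<close> minus the one about
  \<open>T y\<close>. The first is at most \<open>c\<close> by hypothesis, the second asymptotically
  by cm-nonexpansiveness. The supremum on the right ranges over all subsets, so control of full
  windows alone would not do.\<close>

lemma cm_nonexpansive_displacement_le:
  fixes T :: "'a::real_normed_vector \<Rightarrow> 'a"
  assumes cm: "cm_nonexpansive C T" and "y \<in> C" "range v \<subseteq> C"
    and afp: "(\<lambda>i. T (v i) - v i) \<longlonglongrightarrow> 0"
    and window: "\<And>i A. A \<subseteq> {1..n} \<Longrightarrow> norm (\<Sum>k\<in>A. v (i + k) - y) \<le> c"
  shows "real n * norm (T y - y) \<le> 2 * c"
proof (rule field_le_epsilon)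
  fix e :: real assume "e > 0"
  have "limsup (\<lambda>i. ereal (Max ((\<lambda>A. norm (\<Sum>k\<in>A. v (i + k) - y)) ` Pow {1..n}))) \<le> ereal c"
    using window by (intro Limsup_bounded always_eventually allI) (subst ereal_less_eq, rule Max.boundedI, auto)
  moreover have "limsup (\<lambda>i. ereal (Max ((\<lambda>A. norm (\<Sum>k\<in>A. T (v (i + k)) - T y)) ` Pow {1..n})))
        \<le> limsup (\<lambda>i. ereal (Max ((\<lambda>A. norm (\<Sum>k\<in>A. v (i + k) - y)) ` Pow {1..n})))"
    using cm assms(2,3) unfolding cm_nonexpansive_def by blast
  moreover have "ereal c < ereal (c + e / 2)" using \<open>e > 0\<close> by simp
  ultimately have "limsup (\<lambda>i. ereal (Max ((\<lambda>A. norm (\<Sum>k\<in>A. T (v (i + k)) - T y)) ` Pow {1..n})))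
      < ereal (c + e / 2)"
    by (meson le_less_trans)
  then have "\<forall>\<^sub>F i in sequentially.
      ereal (Max ((\<lambda>A. norm (\<Sum>k\<in>A. T (v (i + k)) - T y)) ` Pow {1..n})) < ereal (c + e / 2)"
    by (rule Limsup_lessD)
  then have ev1: "\<forall>\<^sub>F i in sequentially. norm (\<Sum>k\<in>{1..n}. T (v (i + k)) - T y) < c + e / 2"
  proof eventually_elim
    case (elim i)
    \<comment> \<open>Of the supremum on the left only the full window is used.\<close>
    have "norm (\<Sum>k\<in>{1..n}. T (v (i + k)) - T y)
        \<le> Max ((\<lambda>A. norm (\<Sum>k\<in>A. T (v (i + k)) - T y)) ` Pow {1..n})"
      by (rule Max_ge) auto
    also have "\<dots> < c + e / 2" using elim by (simp only: ereal_less_eq less_ereal.simps)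
    finally show ?case .
  qed
  have "(\<lambda>i. \<Sum>k\<in>{1..n}. T (v (i + k)) - v (i + k)) \<longlonglongrightarrow> (\<Sum>k\<in>{1..n}. 0)"
    by (intro tendsto_sum LIMSEQ_ignore_initial_segment afp)
  from tendstoD[OF this, of "e / 2"]
  have "\<forall>\<^sub>F i in sequentially. norm (\<Sum>k\<in>{1..n}. T (v (i + k)) - v (i + k)) < e / 2"
    using \<open>e > 0\<close> by (simp add: dist_norm)
  with ev1 have "\<forall>\<^sub>F i in sequentially. norm (\<Sum>k\<in>{1..n}. T (v (i + k)) - T y) < c + e / 2 \<and>
      norm (\<Sum>k\<in>{1..n}. T (v (i + k)) - v (i + k)) < e / 2"
    by (rule eventually_conj)
  then obtain i where i: "norm (\<Sum>k\<in>{1..n}. T (v (i + k)) - T y) < c + e / 2"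
      "norm (\<Sum>k\<in>{1..n}. T (v (i + k)) - v (i + k)) < e / 2"
    using eventually_happens'[OF sequentially_bot] by blast
  have "real n *\<^sub>R (T y - y) = (\<Sum>k\<in>{1..n}. v (i + k) - y) - (\<Sum>k\<in>{1..n}. T (v (i + k)) - T y)
      + (\<Sum>k\<in>{1..n}. T (v (i + k)) - v (i + k))"
    by (simp add: sum_subtractf sum_constant_scaleR algebra_simps)
  then have "real n * norm (T y - y) = norm ((\<Sum>k\<in>{1..n}. v (i + k) - y)
      - (\<Sum>k\<in>{1..n}. T (v (i + k)) - T y) + (\<Sum>k\<in>{1..n}. T (v (i + k)) - v (i + k)))"
    by (metis norm_scaleR abs_of_nat)
  also have "\<dots> \<le> norm (\<Sum>k\<in>{1..n}. v (i + k) - y) + norm (\<Sum>k\<in>{1..n}. T (v (i + k)) - T y)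
      + norm (\<Sum>k\<in>{1..n}. T (v (i + k)) - v (i + k))"
    by (rule order_trans[OF norm_triangle_ineq add_right_mono[OF norm_triangle_ineq4]])
  finally show "real n * norm (T y - y) \<le> 2 * c + e"
    using i window[of "{1..n}" i] by simp
qed

text \<open>The contractions \<open>(1 - t) *\<^sub>R T x + t *\<^sub>R x\<^sub>0\<close> have fixed
  points by Banach's theorem, and \<open>T\<close> displaces such a point by \<open>t\<close> times
  a bounded vector.\<close>

lemma approximate_fixed_points:
  fixes C :: "'a::banach set"
  assumes C: "C \<noteq> {}" "bounded C" "closed C" "convex C"
    and T: "T ` C \<subseteq> C" "\<And>x y. x \<in> C \<Longrightarrow> y \<in> C \<Longrightarrow> norm (T x - T y) \<le> norm (x - y)"
  shows "\<exists>u. range u \<subseteq> C \<and> (\<lambda>i. T (u i) - u i) \<longlonglongrightarrow> (0::'a)"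
proof -
  obtain x\<^sub>0 where x0: "x\<^sub>0 \<in> C" using C(1) by blast
  obtain B where B: "\<And>x. x \<in> C \<Longrightarrow> norm x \<le> B" using C(2) by (auto simp: bounded_iff)
  let ?t = "\<lambda>i. inverse (real (Suc i))"
  have "\<exists>x\<in>C. (1 - ?t i) *\<^sub>R T x + ?t i *\<^sub>R x\<^sub>0 = x" for i
  proof -
    have t: "0 < ?t i" "?t i \<le> 1" by (auto simp: field_simps)
    have "\<exists>!x\<in>C. (1 - ?t i) *\<^sub>R T x + ?t i *\<^sub>R x\<^sub>0 = x"
    proof (rule Banach_fix)
      show "complete C" using C(3) by (simp add: complete_eq_closed)
      show "(\<lambda>x. (1 - ?t i) *\<^sub>R T x + ?t i *\<^sub>R x\<^sub>0) ` C \<subseteq> C"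
        using C(4) T(1) x0 t by (auto intro!: convexD)
      show "dist ((1 - ?t i) *\<^sub>R T x + ?t i *\<^sub>R x\<^sub>0) ((1 - ?t i) *\<^sub>R T y + ?t i *\<^sub>R x\<^sub>0) \<le> (1 - ?t i) * dist x y"
        if "x \<in> C" "y \<in> C" for x y
      proof -
        have "(1 - ?t i) *\<^sub>R T x + ?t i *\<^sub>R x\<^sub>0 - ((1 - ?t i) *\<^sub>R T y + ?t i *\<^sub>R x\<^sub>0) = (1 - ?t i) *\<^sub>R (T x - T y)"
          by (simp add: scaleR_right_diff_distrib)
        then have "norm ((1 - ?t i) *\<^sub>R T x + ?t i *\<^sub>R x\<^sub>0 - ((1 - ?t i) *\<^sub>R T y + ?t i *\<^sub>R x\<^sub>0)) = \<bar>1 - ?t i\<bar> * norm (T x - T y)"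
          by (metis norm_scaleR)
        also have "\<dots> \<le> (1 - ?t i) * norm (x - y)"
          using t T(2)[OF that] by (simp only: abs_of_nonneg diff_ge_0_iff_ge mult_left_mono)
        finally show ?thesis by (simp only: dist_norm)
      qed
      show "0 \<le> 1 - ?t i" "1 - ?t i < 1" using t by simp_all
    qed (use C(1) in auto)
    then show ?thesis by blast
  qed
  then obtain u where u: "\<And>i. u i \<in> C" "\<And>i. (1 - ?t i) *\<^sub>R T (u i) + ?t i *\<^sub>R x\<^sub>0 = u i"
    by metis
  have "norm (T (u i) - u i) \<le> ?t i * (2 * B)" for i
  proof -
    have "T (u i) - u i = T (u i) - ((1 - ?t i) *\<^sub>R T (u i) + ?t i *\<^sub>R x\<^sub>0)"
      by (simp only: u(2))
    also have "\<dots> = ?t i *\<^sub>R (T (u i) - x\<^sub>0)"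
      by (simp add: scaleR_left_diff_distrib scaleR_right_diff_distrib)
    finally have "norm (T (u i) - u i) = ?t i * norm (T (u i) - x\<^sub>0)"
      by (metis norm_scaleR abs_of_nonneg inverse_nonnegative_iff_nonnegative of_nat_0_le_iff)
    moreover have "norm (T (u i) - x\<^sub>0) \<le> 2 * B"
      using norm_triangle_ineq4[of "T (u i)" x\<^sub>0] B[OF x0] B[of "T (u i)"] T(1) u(1)[of i] by auto
    ultimately show ?thesis
      by (metis inverse_nonnegative_iff_nonnegative mult_left_mono of_nat_0_le_iff)
  qed
  then have "(\<lambda>i. T (u i) - u i) \<longlonglongrightarrow> 0"
    using LIMSEQ_inverse_real_of_nat by (rule_tac tendsto_0_le[of ?t _ _ "2 * B"]) (auto simp: mult.commute)
  with u(1) show ?thesis by (intro exI[of _ u]) auto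
qed

lemma (in bounded_sequence) mean_point_is_fixed:
  assumes cm: "cm_nonexpansive C T" and C: "y \<in> C" "range u \<subseteq> C"
    and afp: "(\<lambda>i. T (u i) - u i) \<longlonglongrightarrow> 0"
    and small: "\<And>e. e > 0 \<Longrightarrow> \<exists>n>0. G n y \<le> e * real n"
  shows "T y = y"
proof -
  have "norm (T y - y) \<le> 0 + e" if "e > 0" for e :: real
  proof -
    \<comment> \<open>A quarter, because a window meets two blocks and
      \<open>cm_nonexpansive_displacement_le\<close> doubles once more.\<close>
    obtain n where n: "n > 0" "\<forall>j. \<exists>i. (\<forall>k. i k \<ge> j) \<and>
        (\<forall>A\<subseteq>{..<n}. norm (\<Sum>k\<in>A. u (i k) - y) \<le> e / 4 * real n)"
      using small_blocks[OF small, of "e / 4"] \<open>e > 0\<close> by auto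
    then obtain i where i: "\<And>j k. i j k \<ge> j"
      "\<And>j A. A \<subseteq> {..<n} \<Longrightarrow> norm (\<Sum>k\<in>A. u (i j k) - y) \<le> e / 4 * real n"
      by metis
    \<comment> \<open>The blocks laid end to end. Entries of block \<open>q\<close> are at least
      \<open>q\<close>, so \<open>s\<close> tends to infinity without being monotone, and the terms
      \<open>u (s t)\<close> are still approximately fixed.\<close>
    define s where "s t = i (t div n) (t mod n)" for t
    have "filterlim (\<lambda>t. t div n) at_top sequentially"
      unfolding filterlim_at_top
    proof
      fix Z :: nat
      have "Z \<le> t div n" if "t \<ge> Z * n" for t
        using div_le_mono[OF that, of n] n(1) by simp
      then show "\<forall>\<^sub>F t in sequentially. Z \<le> t div n"
        by (rule eventually_sequentiallyI)
    qed
    then have s: "filterlim s at_top sequentially"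
      by (rule filterlim_at_top_mono) (auto simp: s_def i)
    have "norm (\<Sum>k\<in>A. u (s (t + k)) - y) \<le> 2 * (e / 4 * real n)" if "A \<subseteq> {1..n}" for t A
      unfolding s_def
      by (rule window_sum_le[where g = "\<lambda>q k. u (i q k) - y"]) (use i n that in auto)
    then have "real n * norm (T y - y) \<le> 2 * (2 * (e / 4 * real n))"
      using C by (intro cm_nonexpansive_displacement_le[OF cm, where v = "\<lambda>t. u (s t)"]
          filterlim_compose[OF afp s]) auto
    then show ?thesis using n(1) by simp
  qed
  then have "norm (T y - y) \<le> 0" by (rule field_le_epsilon)
  then show ?thesis by simp
qed

section \<open>Finite-dimensional spans of scalar sequences\<close>

lemma sum_vscale_closed:
  assumes "finite K" "\<And>k. k \<in> K \<Longrightarrow> g k \<in> V"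
    and V: "vzero \<in> V" "\<And>x y. x \<in> V \<Longrightarrow> y \<in> V \<Longrightarrow> vadd x y \<in> V"
      "\<And>c x. x \<in> V \<Longrightarrow> vscale c x \<in> V"
  shows "(\<lambda>n. \<Sum>k\<in>K. c k * g k n) \<in> V"
  using assms(1,2)
proof (induction K)
  case empty
  then show ?case using V(1) by (simp add: vzero_def)
next
  case (insert k K)
  then have "vadd (vscale (c k) (g k)) (\<lambda>n. \<Sum>k\<in>K. c k * g k n) \<in> V"
    by (intro V) auto
  with insert.hyps show ?case by (simp add: vadd_def vscale_def)
qed

text \<open>Gaussian elimination.  Since entries are bounded by the norm, this bounds the coefficients
  of a vector by its norm without an appeal to compactness.\<close>

lemma fin_span_reconstruct:
  assumes "finite S" "S \<subseteq> V"
    and V: "vzero \<in> V" "\<And>x y. x \<in> V \<Longrightarrow> y \<in> V \<Longrightarrow> vadd x y \<in> V"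
      "\<And>c x. x \<in> V \<Longrightarrow> vscale c x \<in> V"
  shows "\<exists>K g. finite K \<and> (\<forall>k\<in>K. g k \<in> V) \<and>
    (\<forall>y\<in>fin_span S. \<forall>n. y n = (\<Sum>k\<in>K. y k * g k n))"
  using assms(1,2)
proof (induction S)
  case empty
  then show ?case by (intro exI[of _ "{}"]) (auto simp: fin_span_def)
next
  case (insert s S)
  then obtain K g where K: "finite K" "\<And>k. k \<in> K \<Longrightarrow> g k \<in> V"
    and g: "\<And>y n. y \<in> fin_span S \<Longrightarrow> y n = (\<Sum>k\<in>K. y k * g k n)"
    by blast
  have sumV: "(\<lambda>n. \<Sum>k\<in>K. c k * g k n) \<in> V" for c
    using K V by (rule sum_vscale_closed)
  \<comment> \<open>What the coordinates in \<open>K\<close> miss of \<open>s\<close>. If it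
    vanishes, \<open>K\<close> also serves the larger span; otherwise a coordinate where it does not
    vanish becomes the pivot.\<close>
  define s' where "s' n = s n - (\<Sum>k\<in>K. s k * g k n)" for n
  have "s' = vadd s (vscale (-1) (\<lambda>n. \<Sum>k\<in>K. s k * g k n))"
    by (auto simp: s'_def vadd_def vscale_def)
  then have s'V: "s' \<in> V" using insert.prems sumV[of s] V by auto
  have split: "\<exists>c. \<forall>n. y n = (\<Sum>k\<in>K. y k * g k n) + c * s' n" if y: "y \<in> fin_span (insert s S)" for y
  proof -
    obtain c where c: "y = (\<lambda>n. \<Sum>s\<in>insert s S. c s * s n)"
      using y by (auto simp: fin_span_def)
    define t where "t = (\<lambda>n. \<Sum>s\<in>S. c s * s n)"
    have "t \<in> fin_span S" by (auto simp: fin_span_def t_def)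
    then have t: "t n = (\<Sum>k\<in>K. t k * g k n)" for n by (rule g)
    have y_eq: "y n = t n + c s * s n" for n
      using insert.hyps by (simp add: c t_def)
    have "y n = (\<Sum>k\<in>K. y k * g k n) + c s * s' n" for n
    proof -
      have "(\<Sum>k\<in>K. y k * g k n) = (\<Sum>k\<in>K. t k * g k n) + c s * (\<Sum>k\<in>K. s k * g k n)"
        unfolding y_eq by (simp add: sum_distrib_left algebra_simps sum.distrib)
      then show ?thesis using t[of n] by (simp add: y_eq s'_def algebra_simps)
    qed
    then show ?thesis by blast
  qed
  show ?case
  proof (cases "\<forall>n. s' n = 0")
    case True
    then show ?thesis using K split by (intro exI[of _ K] exI[of _ g]) auto
  next
    case False
    then obtain k\<^sub>0 where k0: "s' k\<^sub>0 \<noteq> 0" by blast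
    define h where "h = vscale (inverse (s' k\<^sub>0)) s'"
    have hV: "h \<in> V" using V(3)[OF s'V] by (simp add: h_def)
    have zV: "vscale 0 h \<in> V" using V(3)[OF hV] .
    \<comment> \<open>\<open>h\<close> is 1 at the pivot. Each old \<open>g k\<close> loses its
      pivot entry times \<open>h\<close>, and the pivot receives one copy of \<open>h\<close>.
      Adding the two parts also covers a pivot already in \<open>K\<close>.\<close>
    define g' where "g' k = vadd (if k \<in> K then vadd (g k) (vscale (- g k k\<^sub>0) h) else vscale 0 h)
      (if k = k\<^sub>0 then h else vscale 0 h)" for k
    have "g' k \<in> V" for k
      unfolding g'_def using hV zV K(2) V(2,3) by auto
    moreover have "y n = (\<Sum>k\<in>insert k\<^sub>0 K. y k * g' k n)" if y: "y \<in> fin_span (insert s S)" for y n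
    proof -
      obtain c where c: "\<And>n. y n = (\<Sum>k\<in>K. y k * g k n) + c * s' n"
        using split[OF y] by blast
      have "c * s' k\<^sub>0 = y k\<^sub>0 - (\<Sum>k\<in>K. y k * g k k\<^sub>0)"
        using c[of k\<^sub>0] by simp
      then have "c * s' n = (y k\<^sub>0 - (\<Sum>k\<in>K. y k * g k k\<^sub>0)) * h n"
        using k0 by (simp add: h_def vscale_def flip: \<open>c * s' k\<^sub>0 = _\<close>)
      then have "y n = (\<Sum>k\<in>K. y k * g k n) + (y k\<^sub>0 - (\<Sum>k\<in>K. y k * g k k\<^sub>0)) * h n"
        using c[of n] by simp
      moreover have "(\<Sum>k\<in>insert k\<^sub>0 K. y k * g' k n) =
          (\<Sum>k\<in>insert k\<^sub>0 K. (if k \<in> K then y k * (g k n - g k k\<^sub>0 * h n) else 0))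
          + (\<Sum>k\<in>insert k\<^sub>0 K. if k = k\<^sub>0 then y k * h n else 0)"
        unfolding sum.distrib[symmetric]
        by (rule sum.cong) (auto simp: g'_def vadd_def vscale_def algebra_simps)
      moreover have "(\<Sum>k\<in>insert k\<^sub>0 K. (if k \<in> K then y k * (g k n - g k k\<^sub>0 * h n) else 0))
          = (\<Sum>k\<in>K. y k * (g k n - g k k\<^sub>0 * h n))"
        using K(1) by (intro sum.mono_neutral_cong_right) auto
      moreover have "(\<Sum>k\<in>insert k\<^sub>0 K. if k = k\<^sub>0 then y k * h n else 0) = y k\<^sub>0 * h n"
        using K(1) by simp
      ultimately show ?thesis
        by (simp add: algebra_simps sum_subtractf sum_distrib_left)
    qed
    ultimately show ?thesis
      using K(1) by (intro exI[of _ "insert k\<^sub>0 K"] exI[of _ g']) auto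
  qed
qed

context bounded_sequence
begin

lemma P_sum_le:
  assumes "finite J"
  shows "P n (\<lambda>l. \<Sum>j\<in>J. b j l) (\<Sum>j\<in>J. x j) \<le> (\<Sum>j\<in>J. P n (b j) (x j))"
  using assms
proof (induction J)
  case (insert j J)
  have "P n (\<lambda>l. b j l + (\<Sum>j\<in>J. b j l)) (x j + (\<Sum>j\<in>J. x j))
      \<le> P n (b j) (x j) + P n (\<lambda>l. \<Sum>j\<in>J. b j l) (\<Sum>j\<in>J. x j)"
    by (rule P_triangle)
  with insert show ?case by simp
qed simp

section \<open>Averages bounded away from the space\<close>

text \<open>Averaging the first n translates of a vector a spreads its total mass almost evenly
  over n coordinates; only the O(1) coordinates near both ends see the difference.\<close>

lemma P_spread_le:
  assumes "n > 0"
  shows "P n (\<lambda>_. (\<Sum>k<m. a k) / real n) x \<le> P m a x + M * (\<Sum>k<m. \<bar>a k\<bar> * (2 * real k)) / real n"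
proof -
  \<comment> \<open>The translate of \<open>a\<close> by \<open>j\<close>, written as a sum over
    \<open>k\<close> so that it can be interchanged with averaging over \<open>j\<close>.\<close>
  define sh where "sh j l = (\<Sum>k<m. if l = j + k then a k else 0)" for j l
  define s where "s = (\<Sum>k<m. a k)"
  define c where "c l = (\<Sum>j<n. 1 / real n * sh j l)" for l
  define w where "w l = (if l < n then s / real n else 0)" for l
  have sh: "sh j l = (if l < j then 0 else if l - j < m then a (l - j) else 0)" for j l
  proof -
    have "sh j l = (\<Sum>k<m. if k = l - j then (if l < j then 0 else a k) else 0)"
      unfolding sh_def by (rule sum.cong) auto
    then show ?thesis by auto
  qed
  have shP: "P (n + m) (sh j) x = P m a x" if "j < n" for j
  proof -
    have "P (n + m) (sh j) x = P (j + m) (sh j) x"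
      using that by (intro P_zero_coeff) (auto simp: sh)
    also have "\<dots> = P m (\<lambda>k. if k < m then a k else 0) x"
      unfolding sh by (rule P_shift)
    also have "\<dots> = P m a x" by (rule P_cong) simp
    finally show ?thesis .
  qed
  \<comment> \<open>All translates have the norm of \<open>a\<close> by spreading invariance, so
    their average has at most this norm; the base point is split into \<open>n\<close> equal
    parts.\<close>
  have "P (n + m) c x = P (n + m) (\<lambda>l. \<Sum>j<n. 1 / real n * sh j l) (\<Sum>j<n. (1 / real n) *\<^sub>R x)"
    using assms by (simp add: c_def[abs_def] sum_constant_scaleR)
  also have "\<dots> \<le> (\<Sum>j<n. P (n + m) (\<lambda>l. 1 / real n * sh j l) ((1 / real n) *\<^sub>R x))"
    by (rule P_sum_le) simp
  also have "\<dots> = (\<Sum>j<n. \<bar>1 / real n\<bar> * P (n + m) (sh j) x)"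
    by (simp only: P_scale)
  also have "\<dots> = P m a x"
    using assms by (simp add: shP)
  finally have c: "P (n + m) c x \<le> P m a x" .
  have "P n (\<lambda>_. s / real n) x = P n w x"
    by (rule P_cong) (simp add: w_def)
  also have "\<dots> = P (n + m) w x"
    by (rule P_zero_coeff[symmetric]) (auto simp: w_def)
  also have "\<dots> \<le> P (n + m) c x + M * (\<Sum>l<n + m. \<bar>w l - c l\<bar>)"
    by (rule P_triangle_coeff)
  also have "(\<Sum>l<n + m. \<bar>w l - c l\<bar>) \<le> (\<Sum>k<m. \<bar>a k\<bar> * (2 * real k)) / real n"
  proof -
    \<comment> \<open>In the average the mass \<open>a k\<close> sits evenly on k, ..., k + n - 1,
      in the target on 0, ..., n - 1. These intervals differ in at most 2k places.\<close>
    define d where "d k l = (if l < n then 1 else 0) - (if k \<le> l \<and> l < k + n then 1 else 0 :: real)" for k l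
    have wc: "w l - c l = (\<Sum>k<m. a k * d k l) / real n" for l
    proof -
      have "(\<Sum>j<n. sh j l) = (\<Sum>k<m. \<Sum>j<n. if l = j + k then a k else 0)"
        unfolding sh_def by (rule sum.swap)
      also have "\<dots> = (\<Sum>k<m. a k * (if k \<le> l \<and> l < k + n then 1 else 0))"
      proof (rule sum.cong)
        fix k
        have "(\<Sum>j<n. if l = j + k then a k else 0) = (\<Sum>j<n. if j = l - k then (if k \<le> l then a k else 0) else 0)"
          by (rule sum.cong) auto
        then show "(\<Sum>j<n. if l = j + k then a k else 0) = a k * (if k \<le> l \<and> l < k + n then 1 else 0)"
          using assms by auto
      qed simp
      finally have "c l = (\<Sum>k<m. a k * (if k \<le> l \<and> l < k + n then 1 else 0)) / real n"
        unfolding c_def sum_distrib_left[symmetric] by simp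
      moreover have "w l = (\<Sum>k<m. a k * (if l < n then 1 else 0)) / real n"
        by (simp add: w_def s_def)
      ultimately show ?thesis
        by (simp only: d_def diff_divide_distrib[symmetric] sum_subtractf[symmetric] right_diff_distrib)
    qed
    have d: "(\<Sum>l<n + m. \<bar>d k l\<bar>) \<le> 2 * real k" for k
    proof -
      have "(\<Sum>l<n + m. \<bar>d k l\<bar>) \<le> (\<Sum>l<n + m. if l \<in> {..<k} \<union> {n..<n + k} then 1 else 0)"
        by (rule sum_mono) (auto simp: d_def)
      also have "\<dots> = real (card ({..<n + m} \<inter> ({..<k} \<union> {n..<n + k})))"
        by (simp only: sum.inter_restrict[symmetric] finite_lessThan) simp
      also have "\<dots> \<le> real (card ({..<k} \<union> {n..<n + k}))"
        by (intro of_nat_mono card_mono) auto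
      also have "\<dots> \<le> real (card {..<k} + card {n..<n + k})"
        by (intro of_nat_mono card_Un_le)
      finally show ?thesis by simp
    qed
    have "(\<Sum>l<n + m. \<bar>w l - c l\<bar>) \<le> (\<Sum>l<n + m. (\<Sum>k<m. \<bar>a k\<bar> * \<bar>d k l\<bar>) / real n)"
    proof (rule sum_mono)
      fix l
      have "\<bar>\<Sum>k<m. a k * d k l\<bar> \<le> (\<Sum>k<m. \<bar>a k\<bar> * \<bar>d k l\<bar>)"
        by (rule order_trans[OF sum_abs]) (simp add: abs_mult)
      then show "\<bar>w l - c l\<bar> \<le> (\<Sum>k<m. \<bar>a k\<bar> * \<bar>d k l\<bar>) / real n"
        unfolding wc abs_divide by (simp add: divide_right_mono)
    qed
    also have "\<dots> = (\<Sum>k<m. \<bar>a k\<bar> * (\<Sum>l<n + m. \<bar>d k l\<bar>)) / real n"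
      by (subst sum_divide_distrib[symmetric], subst sum.swap) (simp add: sum_distrib_left)
    also have "\<dots> \<le> (\<Sum>k<m. \<bar>a k\<bar> * (2 * real k)) / real n"
      by (intro divide_right_mono sum_mono mult_left_mono d) auto
    finally show ?thesis .
  qed
  finally show ?thesis
    using c M_pos by (simp add: s_def)
qed

end

locale averages_bounded_below = bounded_sequence +
  fixes \<theta> :: real
  assumes \<theta>_pos: "\<theta> > 0" and G_ge: "\<And>n y. n > 0 \<Longrightarrow> \<theta> * real n \<le> G n y"
begin

lemma P_const_ge:
  assumes "n > 0"
  shows "\<theta> * \<bar>s\<bar> \<le> P n (\<lambda>_. s / real n) x"
proof (cases "s = 0")
  case False
  define c where "c = s / real n"
  have c: "c \<noteq> 0" using False assms by (simp add: c_def)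
  \<comment> \<open>Chosen so that scaling by \<open>c\<close> turns the base point of
    \<open>G n y\<close> into \<open>x\<close>.\<close>
  define y where "y = - (inverse (real n) *\<^sub>R inverse c *\<^sub>R x)"
  have "P n (\<lambda>_. c * 1) (c *\<^sub>R - (real n *\<^sub>R y)) = \<bar>c\<bar> * G n y"
    unfolding G_def by (rule P_scale)
  moreover have "c *\<^sub>R - (real n *\<^sub>R y) = x" using assms c by (simp add: y_def field_simps)
  ultimately have "P n (\<lambda>_. c) x = \<bar>c\<bar> * G n y" by simp
  moreover have "\<bar>c\<bar> * (\<theta> * real n) \<le> \<bar>c\<bar> * G n y"
    using assms by (intro mult_left_mono G_ge) auto
  moreover have "\<bar>c\<bar> * (\<theta> * real n) = \<theta> * \<bar>s\<bar>" using assms by (simp add: c_def)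
  ultimately show ?thesis by (simp add: c_def)
qed simp

text \<open>The error in \<open>P_spread_le\<close> dies out as \<open>n\<close> grows, so
  \<open>a\<close> inherits every lower bound common to the spread-out vectors of the same
  mass.\<close>

lemma P_spread_limit:
  assumes "\<And>n. n > 0 \<Longrightarrow> c \<le> P n (\<lambda>_. (\<Sum>k<m. a k) / real n) x"
  shows "c \<le> P m a x"
proof (rule field_le_epsilon)
  fix e :: real assume "e > 0"
  define B where "B = M * (\<Sum>k<m. \<bar>a k\<bar> * (2 * real k))"
  have "B \<ge> 0" using M_pos by (auto simp: B_def intro!: mult_nonneg_nonneg sum_nonneg)
  obtain n :: nat where n: "B / e < real n" using reals_Archimedean2 by blast
  then have "n > 0" using \<open>B \<ge> 0\<close> \<open>e > 0\<close>
    by (metis divide_nonneg_pos gr0I not_le of_nat_0)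
  moreover have "B / real n \<le> e" using n \<open>e > 0\<close> \<open>n > 0\<close> by (simp add: field_simps)
  ultimately show "c \<le> P m a x + e"
    using assms[of n] P_spread_le[of n a m x] unfolding B_def[symmetric] by linarith
qed

text \<open>Spreading leaves only the total mass, where the hypothesis on averages applies. So the
  summing functional, taken as 0 on the space, is bounded.\<close>

lemma sum_le_P: "\<theta> * \<bar>\<Sum>k<m. a k\<bar> \<le> P m a x"
  by (rule P_spread_limit) (rule P_const_ge)

text \<open>The absolute values of the coefficients may add up to far more than
  \<open>P m a x\<close>, so they cannot be removed directly. After spreading they add up to the
  absolute value of \<open>s\<close> only, which \<open>sum_le_P\<close> controls.\<close>

lemma norm_le_P: "norm x \<le> (1 + M / \<theta>) * P m a x"
proof -
  define s where "s = (\<Sum>k<m. a k)"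
  have "norm x - M * \<bar>s\<bar> \<le> P m a x"
  proof (rule P_spread_limit)
    fix n :: nat assume "n > 0"
    then show "norm x - M * \<bar>s\<bar> \<le> P n (\<lambda>_. (\<Sum>k<m. a k) / real n) x"
      using P_triangle_coeff[of n "\<lambda>_. 0" x "\<lambda>_. s / real n"] by (simp add: s_def)
  qed
  moreover have "M * \<bar>s\<bar> \<le> M / \<theta> * P m a x"
    using sum_le_P[of a m x] \<theta>_pos M_pos by (simp add: s_def field_simps)
  ultimately show ?thesis by (simp add: algebra_simps)
qed

text \<open>A bound for the basis constant of the unit vectors: 1 for the norm at \<open>x\<close>,
  and \<open>1 + M / \<theta>\<close> for moving \<open>x\<close> to 0.\<close>

definition L :: real where "L = 2 + M / \<theta>"

lemma L_pos: "L > 0"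
  using M_pos \<theta>_pos by (simp add: L_def add_pos_pos)

abbreviation p :: "nat \<Rightarrow> seqv \<Rightarrow> real" where
  "p n a \<equiv> P n a 0"

text \<open>Late coordinates enter only through the base point \<open>x\<close>, and
  \<open>norm_le_P\<close> pays for moving it to 0. Truncations are therefore uniformly bounded,
  which is the basis property.\<close>

lemma p_initial: "m \<le> n \<Longrightarrow> p m a \<le> L * p n a"
proof -
  assume "m \<le> n"
  have "p m a / L \<le> P m a x" for x
  proof -
    have "p m a \<le> P m a x + norm x"
      using P_triangle_arg[of m a x "- x"] by simp
    also have "\<dots> \<le> L * P m a x"
      using norm_le_P[of x m a] by (simp add: L_def algebra_simps)
    finally show ?thesis using L_pos by (simp add: field_simps)
  qed
  then have "p m a / L \<le> p n a" using \<open>m \<le> n\<close> by (rule P_ge_inf)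
  then show ?thesis using L_pos by (simp add: field_simps)
qed

lemma p_initial_sum: "m \<le> n \<Longrightarrow> \<theta> * \<bar>\<Sum>k<m. a k\<bar> \<le> p n a"
  by (rule P_ge_inf[OF sum_le_P])

lemma p_vadd: "p n (vadd a b) \<le> p n a + p n b"
  using P_triangle[of n a b 0 0] by (simp add: vadd_def)

lemma p_vscale: "p n (vscale c a) = \<bar>c\<bar> * p n a"
  using P_scale[of n c a 0] by (simp add: vscale_def)

lemma vdiff_eq: "vdiff a b = vadd a (vscale (-1) b)"
  by (simp add: vdiff_def vadd_def vscale_def)

lemma p_vdiff: "p n (vdiff a b) \<le> p n a + p n b"
  using p_vadd[of n a "vscale (-1) b"] by (simp add: vdiff_eq p_vscale)

lemma p_vdiff_commute: "p n (vdiff a b) = p n (vdiff b a)"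
proof -
  have "vdiff a b = vscale (-1) (vdiff b a)" by (simp add: vdiff_def vscale_def)
  then show ?thesis by (simp add: p_vscale)
qed

lemma p_diff_le: "\<bar>p n a - p n b\<bar> \<le> p n (vdiff a b)"
proof -
  have "a = vadd b (vdiff a b)" "b = vadd a (vdiff b a)" by (simp_all add: vdiff_def vadd_def)
  then have "p n a \<le> p n b + p n (vdiff a b)" "p n b \<le> p n a + p n (vdiff b a)"
    by (metis p_vadd)+
  then show ?thesis using p_vdiff_commute[of n a b] by linarith
qed

definition tail :: "nat \<Rightarrow> seqv \<Rightarrow> seqv" where
  "tail m a = (\<lambda>k. if k < m then 0 else a k)"

lemma tail_vadd: "tail m (vadd a b) = vadd (tail m a) (tail m b)"
  and tail_vscale: "tail m (vscale c a) = vscale c (tail m a)"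
  by (auto simp: tail_def vadd_def vscale_def)

lemma p_cut: "m \<le> n \<Longrightarrow> p n (vdiff a (tail m a)) = p m a"
proof -
  assume "m \<le> n"
  then have "p n (vdiff a (tail m a)) = p m (vdiff a (tail m a))"
    by (intro P_zero_coeff) (auto simp: vdiff_def tail_def)
  also have "\<dots> = p m a" by (rule P_cong) (simp add: vdiff_def tail_def)
  finally show ?thesis .
qed

lemma p_tail_zero: "n \<le> m \<Longrightarrow> p n (tail m a) = 0"
  using P_cong[of n "tail m a" "\<lambda>_. 0" 0] by (simp add: tail_def)

lemma p_tail_diff: "m \<le> n \<Longrightarrow> \<bar>p n a - p m a\<bar> \<le> p n (tail m a)"
proof -
  assume "m \<le> n"
  moreover have "vdiff a (vdiff a (tail m a)) = tail m a" by (simp add: vdiff_def)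
  ultimately show ?thesis using p_diff_le[of n a "vdiff a (tail m a)"] p_cut by simp
qed

lemma p_tail_le:
  assumes "\<And>n. p n a \<le> B"
  shows "p n (tail m a) \<le> 2 * B"
proof (cases "m \<le> n")
  case True
  have "tail m a = vdiff a (vdiff a (tail m a))" by (simp add: vdiff_def)
  then have "p n (tail m a) \<le> p n a + p m a"
    using p_vdiff[of n a "vdiff a (tail m a)"] p_cut[OF True] by simp
  then show ?thesis using assms[of n] assms[of m] by linarith
next
  case False
  have "0 \<le> B" using assms[of 0] P_nonneg order_trans by blast
  then show ?thesis using False p_tail_zero[of n m a] by simp
qed

section \<open>The span of the spreading model\<close>

text \<open>The completion of the finitely supported sequences, realised by genuine sequences:
  membership means that the truncations converge. This fits the encoding of Banach spaces inside
  \<open>seqv\<close>.\<close>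

definition model :: "seqv set" where
  "model = {a. \<forall>e>0. \<exists>m\<^sub>0. \<forall>m\<ge>m\<^sub>0. \<forall>n. p n (tail m a) < e}"

text \<open>A limit and not a supremum, since \<open>p n a\<close> need not increase with
  \<open>n\<close>; on \<open>model\<close> the tail condition makes it converge.\<close>

definition model_norm :: "seqv \<Rightarrow> real" where
  "model_norm a = lim (\<lambda>n. p n a)"

lemma modelD: "a \<in> model \<Longrightarrow> e > 0 \<Longrightarrow> \<exists>m\<^sub>0. \<forall>m\<ge>m\<^sub>0. \<forall>n. p n (tail m a) < e"
  unfolding model_def by blast

lemma model_norm_lim:
  assumes "a \<in> model"
  shows "(\<lambda>n. p n a) \<longlonglongrightarrow> model_norm a"
proof -
  have "Cauchy (\<lambda>n. p n a)"
  proof (rule CauchyI')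
    fix e :: real assume "e > 0"
    then obtain m\<^sub>0 where m0: "\<And>m n. m \<ge> m\<^sub>0 \<Longrightarrow> p n (tail m a) < e"
      using modelD[OF assms] by blast
    have "dist (p m a) (p n a) < e" if "m \<ge> m\<^sub>0" "n > m" for m n
      using p_tail_diff[of m n a] m0[of m n] that unfolding dist_real_def by linarith
    then show "\<exists>M. \<forall>m\<ge>M. \<forall>n>m. dist (p m a) (p n a) < e" by blast
  qed
  then show ?thesis
    unfolding model_norm_def by (simp add: Cauchy_convergent_iff convergent_LIMSEQ_iff)
qed

lemma model_norm_nonneg: "a \<in> model \<Longrightarrow> 0 \<le> model_norm a"
  by (rule LIMSEQ_le_const[OF model_norm_lim]) auto

lemma p_le_model_norm: "a \<in> model \<Longrightarrow> p m a \<le> L * model_norm a"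
  by (rule LIMSEQ_le_const[OF tendsto_mult_left[OF model_norm_lim]]) (auto intro: p_initial)

lemma model_norm_le: "a \<in> model \<Longrightarrow> (\<And>n. p n a \<le> B) \<Longrightarrow> model_norm a \<le> B"
  by (rule LIMSEQ_le_const2[OF model_norm_lim]) auto

lemma sum_le_model_norm: "a \<in> model \<Longrightarrow> \<theta> * \<bar>\<Sum>k<m. a k\<bar> \<le> model_norm a"
  by (rule LIMSEQ_le_const[OF model_norm_lim]) (auto intro: p_initial_sum)

lemma coord_le_model_norm:
  assumes "a \<in> model"
  shows "\<bar>a k\<bar> \<le> 2 / \<theta> * model_norm a"
proof -
  \<comment> \<open>A coordinate is the difference of two consecutive partial sums, whence the
    factor 2.\<close>
  have "\<theta> * \<bar>a k\<bar> \<le> \<theta> * \<bar>\<Sum>k<Suc k. a k\<bar> + \<theta> * \<bar>\<Sum>k<k. a k\<bar>"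
    using \<theta>_pos by (simp add: distrib_left[symmetric])
  also have "\<dots> \<le> model_norm a + model_norm a"
    by (intro add_mono sum_le_model_norm assms)
  finally show ?thesis using \<theta>_pos by (simp add: field_simps)
qed

lemma model_vzero: "vzero \<in> model"
proof -
  have "tail m vzero = (\<lambda>_. 0)" for m by (auto simp: tail_def vzero_def)
  then show ?thesis by (simp add: model_def)
qed

lemma model_vadd:
  assumes "a \<in> model" "b \<in> model"
  shows "vadd a b \<in> model"
  unfolding model_def
proof (intro CollectI allI impI)
  fix e :: real assume "e > 0"
  then have "e / 2 > 0" by simp
  obtain m1 where m1: "\<And>m n. m \<ge> m1 \<Longrightarrow> p n (tail m a) < e / 2"
    using modelD[OF assms(1) \<open>e / 2 > 0\<close>] by blast
  obtain m2 where m2: "\<And>m n. m \<ge> m2 \<Longrightarrow> p n (tail m b) < e / 2"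
    using modelD[OF assms(2) \<open>e / 2 > 0\<close>] by blast
  have "p n (tail m (vadd a b)) < e" if "m \<ge> max m1 m2" for m n
    using p_vadd[of n "tail m a" "tail m b"] m1[of m n] m2[of m n] that
    unfolding tail_vadd by simp
  then show "\<exists>m\<^sub>0. \<forall>m\<ge>m\<^sub>0. \<forall>n. p n (tail m (vadd a b)) < e" by blast
qed

lemma model_vscale:
  assumes "a \<in> model"
  shows "vscale c a \<in> model"
  unfolding model_def
proof (intro CollectI allI impI)
  fix e :: real assume "e > 0"
  then have "e / (\<bar>c\<bar> + 1) > 0" by (simp add: add_nonneg_pos)
  then obtain m1 where m1: "\<And>m n. m \<ge> m1 \<Longrightarrow> p n (tail m a) < e / (\<bar>c\<bar> + 1)"
    using modelD[OF assms] by blast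
  have "p n (tail m (vscale c a)) < e" if "m \<ge> m1" for m n
  proof -
    have "\<bar>c\<bar> * p n (tail m a) \<le> (\<bar>c\<bar> + 1) * p n (tail m a)"
      by (intro mult_right_mono) auto
    also have "\<dots> < e" using m1[OF that, of n] by (simp add: pos_less_divide_eq add_nonneg_pos mult.commute)
    finally show ?thesis by (simp add: tail_vscale p_vscale)
  qed
  then show "\<exists>m\<^sub>0. \<forall>m\<ge>m\<^sub>0. \<forall>n. p n (tail m (vscale c a)) < e" by blast
qed

lemma model_vdiff: "a \<in> model \<Longrightarrow> b \<in> model \<Longrightarrow> vdiff a b \<in> model"
  unfolding vdiff_eq by (intro model_vadd model_vscale)

lemma normed_subspace_model: "normed_subspace model model_norm"
  unfolding normed_subspace_def
proof (intro conjI ballI allI)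
  fix x assume x: "x \<in> model"
  show "0 \<le> model_norm x" by (rule model_norm_nonneg[OF x])
  show "model_norm x = 0 \<longleftrightarrow> x = vzero"
  proof
    assume "model_norm x = 0"
    then have "x k = 0" for k using coord_le_model_norm[OF x, of k] by simp
    then show "x = vzero" by (auto simp: vzero_def)
  next
    assume "x = vzero"
    then have "(\<lambda>n. p n x) = (\<lambda>_. 0)" by (simp add: vzero_def)
    then show "model_norm x = 0" by (simp add: model_norm_def)
  qed
  fix c show "model_norm (vscale c x) = \<bar>c\<bar> * model_norm x"
    using LIMSEQ_unique[OF model_norm_lim[OF model_vscale[OF x, of c]]]
      tendsto_mult_left[OF model_norm_lim[OF x], of "\<bar>c\<bar>"] by (simp add: p_vscale)
next
  fix x y assume "x \<in> model" "y \<in> model"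
  then show "model_norm (vadd x y) \<le> model_norm x + model_norm y"
    by (intro LIMSEQ_le[OF model_norm_lim tendsto_add[OF model_norm_lim model_norm_lim]] model_vadd)
       (auto intro: p_vadd)
qed (auto intro: model_vzero model_vadd model_vscale)

lemma banach_subspace_model: "banach_subspace model model_norm"
  unfolding banach_subspace_def
proof (intro conjI normed_subspace_model allI impI)
  fix x :: "nat \<Rightarrow> seqv"
  assume "\<forall>i. x i \<in> model"
    and Cauchy: "\<forall>e>0. \<exists>M. \<forall>m\<ge>M. \<forall>n\<ge>M. model_norm (vdiff (x m) (x n)) < e"
  then have x: "x i \<in> model" for i by blast
  have "convergent (\<lambda>i. x i k)" for k
  proof -
    have "Cauchy (\<lambda>i. x i k)"
    proof (rule metric_CauchyI)
      fix e :: real assume "e > 0"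
      then have "e * \<theta> / 2 > 0" using \<theta>_pos by simp
      then obtain N where N: "\<And>i j. i \<ge> N \<Longrightarrow> j \<ge> N \<Longrightarrow> model_norm (vdiff (x i) (x j)) < e * \<theta> / 2"
        using Cauchy by meson
      have "dist (x i k) (x j k) < e" if "i \<ge> N" "j \<ge> N" for i j
      proof -
        have "\<bar>x i k - x j k\<bar> \<le> 2 / \<theta> * model_norm (vdiff (x i) (x j))"
          using coord_le_model_norm[OF model_vdiff[OF x[of i] x[of j]], of k] by (simp add: vdiff_def)
        also have "\<dots> < e" using N[OF that] \<theta>_pos by (simp add: field_simps)
        finally show ?thesis by (simp add: dist_real_def)
      qed
      then show "\<exists>N. \<forall>i\<ge>N. \<forall>j\<ge>N. dist (x i k) (x j k) < e" by blast
    qed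
    then show ?thesis by (simp add: Cauchy_convergent_iff)
  qed
  then obtain y where y: "\<And>k. (\<lambda>i. x i k) \<longlonglongrightarrow> y k"
    unfolding convergent_def by metis
  \<comment> \<open>The bound has to be uniform in \<open>m\<close>. For each fixed \<open>m\<close>
    it comes from the Cauchy condition as \<open>j\<close> grows, because \<open>p m\<close> depends
    continuously on \<open>m\<close> coordinates.\<close>
  have near: "\<exists>N. \<forall>i\<ge>N. \<forall>m. p m (vdiff (x i) y) \<le> e" if "e > 0" for e :: real
  proof -
    have "e / L > 0" using that L_pos by simp
    then obtain N where N: "\<And>i j. i \<ge> N \<Longrightarrow> j \<ge> N \<Longrightarrow> model_norm (vdiff (x i) (x j)) < e / L"
      using Cauchy by meson
    have "p m (vdiff (x i) y) \<le> e" if "i \<ge> N" for i m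
    proof (rule LIMSEQ_le_const)
      have "(\<lambda>j. e + M * (\<Sum>k<m. \<bar>x j k - y k\<bar>)) \<longlonglongrightarrow> e + M * (\<Sum>k<m. \<bar>y k - y k\<bar>)"
        by (intro tendsto_intros y)
      then show "(\<lambda>j. e + M * (\<Sum>k<m. \<bar>x j k - y k\<bar>)) \<longlonglongrightarrow> e" by simp
      have "p m (vdiff (x i) y) \<le> e + M * (\<Sum>k<m. \<bar>x j k - y k\<bar>)" if "j \<ge> N" for j
      proof -
        have "p m (vdiff (x i) (x j)) \<le> L * model_norm (vdiff (x i) (x j))"
          by (rule p_le_model_norm[OF model_vdiff[OF x x]])
        also have "\<dots> \<le> e" using N[OF \<open>i \<ge> N\<close> that] L_pos by (simp add: field_simps)
        finally show ?thesis
          using P_triangle_coeff[of m "vdiff (x i) y" 0 "vdiff (x i) (x j)"] by (simp add: vdiff_def)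
      qed
      then show "\<exists>N. \<forall>j\<ge>N. p m (vdiff (x i) y) \<le> e + M * (\<Sum>k<m. \<bar>x j k - y k\<bar>)" by blast
    qed
    then show ?thesis by blast
  qed
  have ym: "y \<in> model"
    unfolding model_def
  proof (intro CollectI allI impI)
    fix e :: real assume "e > 0"
    \<comment> \<open>A quarter, because passing to tails by \<open>p_tail_le\<close> doubles the
      bound.\<close>
    then obtain i where i: "\<And>m. p m (vdiff (x i) y) \<le> e / 4"
      using near[of "e / 4"] by auto
    have "e / 2 > 0" using \<open>e > 0\<close> by simp
    then obtain m\<^sub>0 where m0: "\<And>m n. m \<ge> m\<^sub>0 \<Longrightarrow> p n (tail m (x i)) < e / 2"
      using modelD[OF x] by blast
    have "p n (tail m y) < e" if "m \<ge> m\<^sub>0" for m n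
    proof -
      have "tail m y = vdiff (tail m (x i)) (tail m (vdiff (x i) y))"
        by (auto simp: tail_def vdiff_def)
      then have "p n (tail m y) \<le> p n (tail m (x i)) + p n (tail m (vdiff (x i) y))"
        by (metis p_vdiff)
      then show ?thesis using m0[OF that, of n] p_tail_le[OF i, of n m] by linarith
    qed
    then show "\<exists>m\<^sub>0. \<forall>m\<ge>m\<^sub>0. \<forall>n. p n (tail m y) < e" by blast
  qed
  have "\<exists>N. \<forall>i\<ge>N. model_norm (vdiff (x i) y) < e" if "e > 0" for e :: real
  proof -
    obtain N where N: "\<And>i m. i \<ge> N \<Longrightarrow> p m (vdiff (x i) y) \<le> e / 2"
      using near[of "e / 2"] \<open>e > 0\<close> by auto
    have "model_norm (vdiff (x i) y) < e" if "i \<ge> N" for i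
      using model_norm_le[OF model_vdiff[OF x ym] N[OF that]] \<open>e > 0\<close> by linarith
    then show ?thesis by blast
  qed
  with ym show "\<exists>y\<in>model. \<forall>e>0. \<exists>M. \<forall>n\<ge>M. model_norm (vdiff (x n) y) < e" by blast
qed

section \<open>Non-reflexivity of the model\<close>

definition unit :: "nat \<Rightarrow> seqv" where
  "unit k = (\<lambda>n. if n = k then 1 else 0)"

lemma unit_model: "unit k \<in> model"
proof -
  have "tail m (unit k) = (\<lambda>_. 0)" if "m \<ge> Suc k" for m
    using that by (auto simp: tail_def unit_def)
  then show ?thesis unfolding model_def by force
qed

lemma unit_norm_le: "model_norm (unit k) \<le> M"
proof (rule model_norm_le[OF unit_model])
  fix n
  have "(\<Sum>j<n. \<bar>unit k j\<bar>) = (\<Sum>j<n. if j = k then 1 else 0)"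
    by (rule sum.cong) (auto simp: unit_def)
  also have "\<dots> \<le> 1" by simp
  finally have "M * (\<Sum>j<n. \<bar>unit k j\<bar>) \<le> M * 1"
    using M_pos by (intro mult_left_mono) auto
  then show "p n (unit k) \<le> M" using P_le[of n "unit k" 0] by simp
qed

lemma dual_unit_le:
  assumes "f \<in> dual_space model model_norm"
  shows "\<bar>f (unit k)\<bar> \<le> M * dual_norm model model_norm f"
proof -
  let ?S = "{\<bar>f x\<bar> |x. x \<in> model \<and> model_norm x \<le> 1}"
  obtain B where lin: "\<And>a x y. x \<in> model \<Longrightarrow> y \<in> model \<Longrightarrow> f (vadd (vscale a x) y) = a * f x + f y"
    and B: "\<And>x. x \<in> model \<Longrightarrow> \<bar>f x\<bar> \<le> B * model_norm x"
    using assms unfolding dual_space_def by blast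
  have bdd: "bdd_above ?S"
  proof (rule bdd_aboveI)
    fix t assume "t \<in> ?S"
    then obtain x where x: "t = \<bar>f x\<bar>" "x \<in> model" "model_norm x \<le> 1" by blast
    have "t \<le> B * model_norm x" using B x by simp
    also have "\<dots> \<le> \<bar>B\<bar> * 1"
      using x model_norm_nonneg[of x] by (intro mult_mono) auto
    finally show "t \<le> \<bar>B\<bar>" by simp
  qed
  define x where "x = vscale (inverse M) (unit k)"
  have x: "x \<in> model" by (simp add: x_def model_vscale unit_model)
  have "model_norm x = inverse M * model_norm (unit k)"
    using normed_subspace_model M_pos unit_model by (simp add: x_def normed_subspace_def)
  also have "\<dots> \<le> 1" using unit_norm_le[of k] M_pos by (simp add: field_simps)
  finally have "\<bar>f x\<bar> \<le> dual_norm model model_norm f"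
    unfolding dual_norm_def using x by (intro cSup_upper bdd) auto
  moreover have "f x = inverse M * f (unit k)"
  proof -
    have "model_norm vzero = 0"
      using normed_subspace_model model_vzero unfolding normed_subspace_def by blast
    then have "f vzero = 0" using B[OF model_vzero] by simp
    moreover have "vadd x vzero = x" by (simp add: vadd_def vzero_def)
    ultimately show ?thesis
      using lin[OF unit_model model_vzero, of "inverse M" k] by (simp add: x_def)
  qed
  ultimately show ?thesis using M_pos by (simp add: abs_mult field_simps)
qed

text \<open>A cluster point of the unit vectors in the bidual annihilates every coordinate
  functional but not the summing functional, hence it is not an evaluation.\<close>

lemma model_not_reflexive: "\<not> reflexive_space model model_norm"
proof
  assume refl: "reflexive_space model model_norm"
  let ?D = "dual_space model model_norm"
  define \<Phi> where "\<Phi> f = clim (\<lambda>k. f (unit k))" for f :: "seqv \<Rightarrow> real"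
  have bdd: "bounded (range (\<lambda>k. f (unit k)))" if "f \<in> ?D" for f
    unfolding bounded_iff using dual_unit_le[OF that] by auto
  have linear: "\<Phi> (\<lambda>x. a * f x + g x) = a * \<Phi> f + \<Phi> g" if "f \<in> ?D" "g \<in> ?D" for a f g
    unfolding \<Phi>_def using that by (intro clim_linear bdd)
  have le: "\<bar>\<Phi> f\<bar> \<le> M * dual_norm model model_norm f" if "f \<in> ?D" for f
  proof -
    have "- (M * dual_norm model model_norm f) \<le> \<Phi> f"
      unfolding \<Phi>_def using dual_unit_le[OF that] by (intro clim_ge[OF bdd[OF that], of 0]) (simp add: abs_le_iff minus_le_iff)
    moreover have "\<Phi> f \<le> M * dual_norm model model_norm f"
      unfolding \<Phi>_def using dual_unit_le[OF that] by (intro clim_le[OF bdd[OF that], of 0]) (simp add: abs_le_iff)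
    ultimately show ?thesis by linarith
  qed
  have "\<exists>x\<in>model. \<forall>f\<in>?D. \<Phi> f = f x"
    by (rule mp[OF spec[OF refl[unfolded reflexive_space_def], of \<Phi>]]) (use linear le in blast)
  then obtain y where y: "y \<in> model" "\<And>f. f \<in> ?D \<Longrightarrow> \<Phi> f = f y"
    by blast
  \<comment> \<open>Members of \<open>dual_space\<close> are 0 off the subspace;
    \<open>total\<close> below gets the same default.\<close>
  define coord where "coord k x = (if x \<in> model then x k else 0)" for k :: nat and x :: seqv
  have coord: "coord k \<in> ?D" for k
    unfolding dual_space_def
  proof (intro CollectI conjI allI ballI impI)
    show "coord k (vadd (vscale a x) y) = a * coord k x + coord k y"
      if "x \<in> model" "y \<in> model" for a x y
      using that model_vadd[OF model_vscale[of x a], of y]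
      by (simp add: coord_def) (simp add: vadd_def vscale_def)
    show "\<exists>B. \<forall>x\<in>model. \<bar>coord k x\<bar> \<le> B * model_norm x"
      using coord_le_model_norm[of _ k] by (intro exI[of _ "2 / \<theta>"]) (simp add: coord_def)
  qed (simp add: coord_def)
  have "y k = 0" for k
  proof -
    have "\<Phi> (coord k) = 0"
      unfolding \<Phi>_def by (rule clim_eventually_const[of "Suc k"]) (auto simp: coord_def unit_def)
    then show ?thesis using y coord by (simp add: coord_def)
  qed
  define total where "total x = (if x \<in> model then lim (\<lambda>m. \<Sum>k<m. x k) else 0)" for x :: seqv
  have total_lim: "(\<lambda>m. \<Sum>k<m. x k) \<longlonglongrightarrow> total x" if x: "x \<in> model" for x
  proof -
    \<comment> \<open>A stretch of the series is a partial sum of a tail, which the bounded summing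
      functional makes small.\<close>
    have "Cauchy (\<lambda>m. \<Sum>k<m. x k)"
    proof (rule CauchyI')
      fix e :: real assume "e > 0"
      then have "\<theta> * e > 0" using \<theta>_pos by simp
      then obtain m\<^sub>0 where m0: "\<And>m n. m \<ge> m\<^sub>0 \<Longrightarrow> p n (tail m x) < \<theta> * e"
        using modelD[OF x] by blast
      have "dist (\<Sum>k<m. x k) (\<Sum>k<n. x k) < e" if "m \<ge> m\<^sub>0" "n > m" for m n
      proof -
        have "(\<Sum>k<n. tail m x k) = (\<Sum>k<n. x k) - (\<Sum>k<n. if k < m then x k else 0)"
          unfolding sum_subtractf[symmetric] by (rule sum.cong) (auto simp: tail_def)
        also have "(\<Sum>k<n. if k < m then x k else 0) = (\<Sum>k<m. x k)"
          using \<open>n > m\<close> by (intro sum.mono_neutral_cong_right) auto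
        finally have "\<theta> * \<bar>(\<Sum>k<n. x k) - (\<Sum>k<m. x k)\<bar> < \<theta> * e"
          using p_initial_sum[of n n "tail m x"] m0[OF that(1), of n] by simp
        then show ?thesis using \<theta>_pos by (simp add: dist_real_def abs_minus_commute)
      qed
      then show "\<exists>M. \<forall>m\<ge>M. \<forall>n>m. dist (\<Sum>k<m. x k) (\<Sum>k<n. x k) < e" by blast
    qed
    then show ?thesis
      using x by (simp add: total_def Cauchy_convergent_iff convergent_LIMSEQ_iff)
  qed
  have "total \<in> ?D"
    unfolding dual_space_def
  proof (intro CollectI conjI allI ballI impI)
    show "total x = 0" if "x \<notin> model" for x using that by (simp add: total_def)
    show "total (vadd (vscale a x) y) = a * total x + total y" if "x \<in> model" "y \<in> model" for a x y
    proof (rule LIMSEQ_unique[OF total_lim])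
      show "vadd (vscale a x) y \<in> model" using that by (intro model_vadd model_vscale)
      have "(\<lambda>m. a * (\<Sum>k<m. x k) + (\<Sum>k<m. y k)) \<longlonglongrightarrow> a * total x + total y"
        using that by (intro tendsto_intros total_lim)
      then show "(\<lambda>m. \<Sum>k<m. vadd (vscale a x) y k) \<longlonglongrightarrow> a * total x + total y"
        by (simp add: vadd_def vscale_def sum.distrib sum_distrib_left)
    qed
    have "\<bar>total x\<bar> \<le> 1 / \<theta> * model_norm x" if "x \<in> model" for x
    proof (rule LIMSEQ_le_const2[OF tendsto_rabs[OF total_lim[OF that]]])
      have "\<bar>\<Sum>k<m. x k\<bar> \<le> 1 / \<theta> * model_norm x" for m
        using sum_le_model_norm[OF that, of m] \<theta>_pos by (simp add: field_simps)
      then show "\<exists>N. \<forall>m\<ge>N. \<bar>\<Sum>k<m. x k\<bar> \<le> 1 / \<theta> * model_norm x" by blast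
    qed
    then show "\<exists>B. \<forall>x\<in>model. \<bar>total x\<bar> \<le> B * model_norm x" by blast
  qed
  have "total (unit j) = 1" for j
  proof (rule LIMSEQ_unique[OF total_lim[OF unit_model]])
    have "(\<Sum>k<m. unit j k) = 1" if "m \<ge> Suc j" for m
      using that by (simp add: unit_def)
    then show "(\<lambda>m. \<Sum>k<m. unit j k) \<longlonglongrightarrow> 1"
      by (intro tendsto_eventually eventually_sequentiallyI)
  qed
  then have "\<Phi> total = 1" by (simp add: \<Phi>_def)
  moreover have "total y = 0"
    using \<open>\<And>k. y k = 0\<close> by (simp add: total_def)
  ultimately show False using y(2)[OF \<open>total \<in> ?D\<close>] by simp
qed

section \<open>Finite representability of the model in the space\<close>

lemma uniform_approx:
  assumes "e > 0"
  shows "\<exists>i. \<forall>a t. t > 0 \<longrightarrow> (\<forall>k<m. \<bar>a k\<bar> \<le> t) \<longrightarrow>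
    \<bar>norm (\<Sum>k<m. a k *\<^sub>R u (i k)) - p m a\<bar> \<le> e * t"
proof -
  \<comment> \<open>Moving \<open>m\<close> coefficients by at most \<open>h\<close> each changes
    both norms by at most a third of \<open>e\<close>. The summand 1 keeps the denominator positive
    for \<open>m = 0\<close>.\<close>
  define h where "h = e / (3 * M * (real m + 1))"
  have h: "h > 0" using assms M_pos by (simp add: h_def)
  have Mh: "M * (real m * h) \<le> e / 3"
  proof -
    have "real m / (real m + 1) \<le> 1" by simp
    moreover have "M * (real m * h) = e / 3 * (real m / (real m + 1))"
      using M_pos by (simp add: h_def)
    ultimately show ?thesis
      using mult_left_mono[of "real m / (real m + 1)" 1 "e / 3"] assms by simp
  qed
  \<comment> \<open>Only finitely many coefficient tuples can be approximated at once, so the unit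
    cube is replaced by a finite net. Homogeneity later passes from the cube to any bound
    \<open>t\<close>.\<close>
  obtain F where F: "finite F" "{-1..1::real} \<subseteq> (\<Union>c\<in>F. ball c h)"
    using compact_Icc[of "-1" "1::real"] h unfolding compact_eq_totally_bounded by blast
  define Q where "Q = (\<lambda>a. (a, 0::'a)) ` PiE {..<m} (\<lambda>_. F)"
  have "finite Q" using F(1) by (simp add: Q_def finite_PiE)
  then obtain i where i: "\<forall>(a, x)\<in>Q. \<bar>norm (x + (\<Sum>k<m. a k *\<^sub>R u (i k))) - P m a x\<bar> < e / 3"
    using P_approx[of Q "e / 3" 0 m] assms by auto
  have one: "\<bar>norm (\<Sum>k<m. a k *\<^sub>R u (i k)) - p m a\<bar> \<le> e" if a: "\<And>k. k < m \<Longrightarrow> \<bar>a k\<bar> \<le> 1" for a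
  proof -
    have "\<exists>c\<in>F. \<bar>a k - c\<bar> \<le> h" if "k < m" for k
    proof -
      have "a k \<in> {-1..1}" using a[OF that] by auto
      then obtain c where "c \<in> F" "dist c (a k) < h" using F(2) by auto
      then show ?thesis by (intro bexI[of _ c]) (auto simp: dist_real_def)
    qed
    then obtain c where c: "\<And>k. k < m \<Longrightarrow> c k \<in> F" "\<And>k. k < m \<Longrightarrow> \<bar>a k - c k\<bar> \<le> h"
      by metis
    define b where "b = restrict c {..<m}"
    have "(b, 0) \<in> Q" using c(1) by (auto simp: Q_def b_def)
    then have b: "\<bar>norm (\<Sum>k<m. b k *\<^sub>R u (i k)) - p m b\<bar> < e / 3"
      using i by auto
    have ab: "\<bar>a k - b k\<bar> \<le> h" if "k < m" for k using c(2)[OF that] that by (simp add: b_def)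
    have s: "(\<Sum>k<m. \<bar>a k - b k\<bar>) \<le> real m * h"
      using sum_bounded_above[of "{..<m}" "\<lambda>k. \<bar>a k - b k\<bar>" h] ab by simp
    have Ms: "M * (\<Sum>k<m. \<bar>a k - b k\<bar>) \<le> e / 3"
      using mult_left_mono[OF s, of M] M_pos Mh by linarith
    have p1: "p m a \<le> p m b + M * (\<Sum>k<m. \<bar>a k - b k\<bar>)" by (rule P_triangle_coeff)
    have p2: "p m b \<le> p m a + M * (\<Sum>k<m. \<bar>a k - b k\<bar>)"
      using P_triangle_coeff[of m b 0 a] by (simp add: abs_minus_commute)
    have "norm ((\<Sum>k<m. a k *\<^sub>R u (i k)) - (\<Sum>k<m. b k *\<^sub>R u (i k))) = norm (\<Sum>k<m. (a k - b k) *\<^sub>R u (i k))"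
      by (simp add: sum_subtractf scaleR_left_diff_distrib)
    also have "\<dots> \<le> (\<Sum>k<m. \<bar>a k - b k\<bar> * M)"
      by (rule sum_norm_le) (auto intro!: mult_left_mono norm_le)
    also have "\<dots> = M * (\<Sum>k<m. \<bar>a k - b k\<bar>)" by (simp add: sum_distrib_left mult.commute)
    finally have "\<bar>norm (\<Sum>k<m. a k *\<^sub>R u (i k)) - norm (\<Sum>k<m. b k *\<^sub>R u (i k))\<bar> \<le> M * (\<Sum>k<m. \<bar>a k - b k\<bar>)"
      using norm_triangle_ineq3 order_trans by blast
    then show ?thesis using b Ms p1 p2 by linarith
  qed
  have "\<bar>norm (\<Sum>k<m. a k *\<^sub>R u (i k)) - p m a\<bar> \<le> e * t" if t: "t > 0" "\<forall>k<m. \<bar>a k\<bar> \<le> t" for a t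
  proof -
    have "\<bar>norm (\<Sum>k<m. vscale (inverse t) a k *\<^sub>R u (i k)) - p m (vscale (inverse t) a)\<bar> \<le> e"
      using t by (intro one) (simp add: vscale_def abs_mult field_simps)
    moreover have "norm (\<Sum>k<m. vscale (inverse t) a k *\<^sub>R u (i k)) = inverse t * norm (\<Sum>k<m. a k *\<^sub>R u (i k))"
    proof -
      have "(\<Sum>k<m. vscale (inverse t) a k *\<^sub>R u (i k)) = inverse t *\<^sub>R (\<Sum>k<m. a k *\<^sub>R u (i k))"
        by (simp add: vscale_def scaleR_sum_right)
      then show ?thesis using t(1) by simp
    qed
    ultimately have "inverse t * \<bar>norm (\<Sum>k<m. a k *\<^sub>R u (i k)) - p m a\<bar> \<le> e"
      using t(1) by (simp add: p_vscale right_diff_distrib[symmetric] abs_mult)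
    then show ?thesis using t(1) by (simp add: field_simps)
  qed
  then show ?thesis by blast
qed

text \<open>Two approximations of relative error \<open>\<eta> / 2\<close> are combined: cutting all
  of the span at a common length \<open>m\<close>, and replacing the first \<open>m\<close> unit
  vectors by terms of \<open>u\<close>. Both are uniform because the norm of \<open>y\<close> bounds
  its coordinates.\<close>

lemma fin_representable_model: "fin_representable model model_norm TYPE('a)"
  unfolding fin_representable_def
proof (intro allI impI)
  fix S and e :: real
  assume S: "finite S \<and> S \<subseteq> model" and "e > 0"
  obtain K g where K: "finite K" "\<And>k. k \<in> K \<Longrightarrow> g k \<in> model"
    and g: "\<And>y n. y \<in> fin_span S \<Longrightarrow> y n = (\<Sum>k\<in>K. y k * g k n)"
    using fin_span_reconstruct[OF conjunct1[OF S] conjunct2[OF S] model_vzero model_vadd model_vscale]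
    by blast
  have span_model: "y \<in> model" if "y \<in> fin_span S" for y
  proof -
    have "y = (\<lambda>n. \<Sum>k\<in>K. y k * g k n)" using g[OF that] by blast
    also have "\<dots> \<in> model"
      using K model_vzero model_vadd model_vscale by (rule sum_vscale_closed)
    finally show ?thesis .
  qed
  \<comment> \<open>Solves (1 + \<eta>) / (1 - \<eta>) = 1 + e. The division by 1 - \<eta> in
    \<open>J\<close> turns a two-sided error into the required one-sided form.\<close>
  define \<eta> where "\<eta> = e / (2 + e)"
  have \<eta>: "0 < \<eta>" "\<eta> < 1" "1 + \<eta> = (1 + e) * (1 - \<eta>)"
    using \<open>e > 0\<close> by (auto simp: \<eta>_def field_simps)
  \<comment> \<open>A tail of \<open>y\<close> combines the tails of the \<open>card K\<close>
    vectors \<open>g k\<close> with coefficients at most \<open>2 / \<theta>\<close> times the norm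
    of \<open>y\<close>; this \<open>d\<close> keeps the total below \<open>\<eta> / 2\<close> times
    that norm.\<close>
  define d where "d = \<eta> * \<theta> / (4 * (real (card K) + 1))"
  have "d > 0" using \<eta> \<theta>_pos by (simp add: d_def add_nonneg_pos)
  have "\<forall>k\<in>K. \<exists>m\<^sub>0. \<forall>m\<ge>m\<^sub>0. \<forall>n. p n (tail m (g k)) < d"
    using K(2) \<open>d > 0\<close> unfolding model_def by blast
  then obtain \<mu> where \<mu>: "\<And>k m n. k \<in> K \<Longrightarrow> m \<ge> \<mu> k \<Longrightarrow> p n (tail m (g k)) < d"
    by metis
  define m where "m = Max (insert 0 (\<mu> ` K))"
  have m: "p n (tail m (g k)) < d" if "k \<in> K" for k n
    using \<mu>[OF that, of m n] K(1) that by (simp add: m_def)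
  have cut: "\<bar>model_norm y - p m y\<bar> \<le> \<eta> / 2 * model_norm y" if y: "y \<in> fin_span S" for y
  proof -
    have ym: "y \<in> model" by (rule span_model[OF y])
    have tail_le: "p n (tail m y) \<le> \<eta> / 2 * model_norm y" for n
    proof -
      have "tail m y = (\<lambda>l. \<Sum>k\<in>K. vscale (y k) (tail m (g k)) l)"
      proof
        fix l
        show "tail m y l = (\<Sum>k\<in>K. vscale (y k) (tail m (g k)) l)"
          using g[OF y, of l] by (simp add: tail_def vscale_def)
      qed
      then have "p n (tail m y) \<le> (\<Sum>k\<in>K. p n (vscale (y k) (tail m (g k))))"
        using P_sum_le[OF K(1), of n "\<lambda>k. vscale (y k) (tail m (g k))" "\<lambda>_. 0"] by simp
      also have "\<dots> \<le> (\<Sum>k\<in>K. 2 / \<theta> * model_norm y * d)"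
        unfolding p_vscale using coord_le_model_norm[OF ym] m \<theta>_pos model_norm_nonneg[OF ym]
        by (intro sum_mono mult_mono) (auto intro: less_imp_le)
      also have "\<dots> = real (card K) * (2 / \<theta> * d) * model_norm y" by simp
      also have "real (card K) * (2 / \<theta> * d) \<le> \<eta> / 2"
        using \<theta>_pos \<eta>(1) by (simp add: d_def field_simps)
      finally show ?thesis using model_norm_nonneg[OF ym] by (simp add: mult_right_mono)
    qed
    have "(\<lambda>n. \<bar>p n y - p m y\<bar>) \<longlonglongrightarrow> \<bar>model_norm y - p m y\<bar>"
      by (intro tendsto_intros model_norm_lim ym)
    then show ?thesis
      by (rule LIMSEQ_le_const2) (use p_tail_diff tail_le order_trans in blast)
  qed
  obtain i where i: "\<And>a t. t > 0 \<Longrightarrow> \<forall>k<m. \<bar>a k\<bar> \<le> t \<Longrightarrow>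
      \<bar>norm (\<Sum>k<m. a k *\<^sub>R u (i k)) - p m a\<bar> \<le> \<eta> * \<theta> / 4 * t"
    using uniform_approx[of "\<eta> * \<theta> / 4" m] \<eta>(1) \<theta>_pos by auto
  have approx: "\<bar>norm (\<Sum>k<m. y k *\<^sub>R u (i k)) - model_norm y\<bar> \<le> \<eta> * model_norm y"
    if y: "y \<in> fin_span S" for y
  proof (cases "model_norm y = 0")
    case True
    then have "y k = 0" for k using coord_le_model_norm[OF span_model[OF y], of k] by simp
    then show ?thesis using True by simp
  next
    case False
    then have pos: "model_norm y > 0" using model_norm_nonneg[OF span_model[OF y]] by simp
    have "\<bar>norm (\<Sum>k<m. y k *\<^sub>R u (i k)) - p m y\<bar> \<le> \<eta> * \<theta> / 4 * (2 / \<theta> * model_norm y)"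
      using pos \<theta>_pos coord_le_model_norm[OF span_model[OF y]] by (intro i) auto
    also have "\<dots> = \<eta> / 2 * model_norm y" using \<theta>_pos by simp
    finally show ?thesis using cut[OF y] by linarith
  qed
  define J where "J y = inverse (1 - \<eta>) *\<^sub>R (\<Sum>k<m. y k *\<^sub>R u (i k))" for y
  show "\<exists>J::seqv \<Rightarrow> 'a.
      (\<forall>a. \<forall>x\<in>fin_span S. \<forall>y\<in>fin_span S. J (vadd (vscale a x) y) = a *\<^sub>R J x + J y) \<and>
      (\<forall>y\<in>fin_span S. model_norm y \<le> norm (J y) \<and> norm (J y) \<le> (1 + e) * model_norm y)"
  proof (intro exI[of _ J] conjI ballI allI)
    fix a x y
    show "J (vadd (vscale a x) y) = a *\<^sub>R J x + J y"
      by (simp add: J_def vadd_def vscale_def scaleR_left_distrib sum.distrib scaleR_right_distrib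
          scaleR_sum_right mult.commute mult.left_commute)
  next
    fix y assume y: "y \<in> fin_span S"
    let ?s = "norm (\<Sum>k<m. y k *\<^sub>R u (i k))"
    have J: "norm (J y) = ?s / (1 - \<eta>)"
      using \<eta> by (simp add: J_def divide_inverse mult.commute)
    have s: "(1 - \<eta>) * model_norm y \<le> ?s" "?s \<le> (1 + \<eta>) * model_norm y"
      using approx[OF y] unfolding abs_le_iff by (auto simp: algebra_simps)
    show "model_norm y \<le> norm (J y)"
      using s(1) \<eta> unfolding J by (simp add: pos_le_divide_eq mult.commute)
    show "norm (J y) \<le> (1 + e) * model_norm y"
      using s(2) \<eta>(2) unfolding J \<eta>(3) by (simp add: pos_divide_le_eq mult_ac)
  qed
qed

end

section \<open>The dichotomy and the fixed point theorem\<close>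

lemma (in bounded_sequence) small_G_exists:
  assumes "\<And>V N. banach_subspace V N \<Longrightarrow> fin_representable V N TYPE('a) \<Longrightarrow> reflexive_space V N"
    and "e > 0"
  shows "\<exists>n>0. \<exists>y. G n y \<le> e * real n"
proof (rule ccontr)
  assume "\<not> ?thesis"
  then have "e * real n \<le> G n y" if "n > 0" for n y
    using that by (meson linear)
  \<comment> \<open>The negated claim gives one lower bound for all \<open>n\<close> and
    \<open>y\<close>, so \<open>e\<close> itself serves as \<theta>.\<close>
  then interpret averages_bounded_below u M e
    using assms(2) by unfold_locales auto
  show False
    using model_not_reflexive assms(1)[OF banach_subspace_model fin_representable_model] by blast
qed

theorem theorem4p7:
  assumes "super_reflexive TYPE('a::banach)"
  shows "\<forall>C :: 'a set. \<forall>T. C \<noteq> {} \<and> bounded C \<and> closed C \<and> convex C \<and> cm_nonexpansive C T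
           \<longrightarrow> (\<exists>x\<in>C. T x = x)"
proof (intro allI impI, elim conjE)
  fix C :: "'a set" and T
  assume C: "C \<noteq> {}" "bounded C" "closed C" "convex C" and cm: "cm_nonexpansive C T"
  obtain u where u: "range u \<subseteq> C" and afp: "(\<lambda>i. T (u i) - u i) \<longlonglongrightarrow> 0"
    using approximate_fixed_points[OF C, of T] cm unfolding cm_nonexpansive_def by blast
  obtain M where M: "M > 0" "\<And>x. x \<in> C \<Longrightarrow> norm x \<le> M"
    using C(2) unfolding bounded_pos by blast
  interpret bounded_sequence u M
    using M u by unfold_locales auto
  have "\<exists>n>0. \<exists>y. G n y \<le> e * real n" if "e > 0" for e
    using assms that unfolding super_reflexive_def by (intro small_G_exists) auto
  then obtain y where y: "\<And>e. e > 0 \<Longrightarrow> \<exists>n>0. G n y \<le> e * real n"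
    using mean_point_exists[OF complete_UNIV] by blast
  have "y \<in> C" by (rule mean_point_in_closed_convex[OF C(3,4) u y])
  with mean_point_is_fixed[OF cm _ u afp y] show "\<exists>x\<in>C. T x = x" by blast
qed

end
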